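(* Let $d \geq 1$ and $\widetilde Z \sim \widetilde Z(2n, n^{-\alpha})$. If $\alpha < 1/d$, then with overwhelming probability $H_{2d}(\widetilde Z; \mathbb{Q}) = 0$. If $\alpha < 1/(d+1)$, then with overwhelming probability $H_{2d-1}(\widetilde Z; \mathbb{Q}) = 0$.
   Context: For a finite simple graph $G$, $\widetilde Z(G)$ is the simplicial complex on $V(G)\times\{-1,+1\}$ whose faces are $(\sigma\times\{-1\})\cup(\tau\times\{+1\})$ for (possibly empty) cliques $\sigma,\tau$ of $G$ that are disjoint with no edge of $G$ between them (the separated deleted join of the clique complex of $G$). $\widetilde Z(2n,p)$ is the distribution of $\widetilde Z(G)$ for $G\sim G(n,p)$, the Erdős–Rényi random graph on $[n]$. Here $\alpha>0$. "With overwhelming probability" means with probability at least $1-n^{-\omega(1)}$ as $n\to\infty$. *)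

theory Defs
  imports Complex_Main "HOL-Library.Product_Lexorder"
begin

definition all_edges :: "nat \<Rightarrow> nat set set" where
  "all_edges n = {e. e \<subseteq> {1..n} \<and> card e = 2}"

definition prob_Gnp :: "nat \<Rightarrow> real \<Rightarrow> (nat set set \<Rightarrow> bool) \<Rightarrow> real" where
  "prob_Gnp n p P =
     (\<Sum>E\<in>Pow (all_edges n).
        (if P E then p ^ card E * (1 - p) ^ (card (all_edges n) - card E) else 0))"

definition overwhelming :: "(nat \<Rightarrow> real) \<Rightarrow> (nat \<Rightarrow> nat set set \<Rightarrow> bool) \<Rightarrow> bool" where
  "overwhelming p P \<longleftrightarrow>
     (\<forall>C>0. eventually (\<lambda>n. 1 - prob_Gnp n (p n) (P n) \<le> real n powr (- C)) at_top)"

definition is_clique :: "nat \<Rightarrow> nat set set \<Rightarrow> nat set \<Rightarrow> bool" where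
  "is_clique n E S \<longleftrightarrow> S \<subseteq> {1..n} \<and> (\<forall>x\<in>S. \<forall>y\<in>S. x \<noteq> y \<longrightarrow> {x, y} \<in> E)"

definition Ztilde :: "nat \<Rightarrow> nat set set \<Rightarrow> (nat \<times> int) set set" where
  "Ztilde n E = {(\<sigma> \<times> {-1}) \<union> (\<tau> \<times> {1}) | \<sigma> \<tau>.
      is_clique n E \<sigma> \<and> is_clique n E \<tau> \<and> \<sigma> \<inter> \<tau> = {} \<and>
      (\<forall>x\<in>\<sigma>. \<forall>y\<in>\<tau>. {x, y} \<notin> E)}"

text \<open>A k-chain: rational coefficients on k-faces (faces with k+1 vertices);
  orientation given by the increasing order of vertices.\<close>
definition is_chain :: "'v set set \<Rightarrow> nat \<Rightarrow> ('v set \<Rightarrow> rat) \<Rightarrow> bool" where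
  "is_chain K k c \<longleftrightarrow> (\<forall>\<sigma>. c \<sigma> \<noteq> 0 \<longrightarrow> \<sigma> \<in> K \<and> finite \<sigma> \<and> card \<sigma> = Suc k)"

definition bdry :: "('v::linorder) set set \<Rightarrow> ('v set \<Rightarrow> rat) \<Rightarrow> 'v set \<Rightarrow> rat" where
  "bdry K c \<tau> = (\<Sum>\<sigma>\<in>{\<sigma>\<in>K. \<tau> \<subseteq> \<sigma> \<and> finite \<sigma> \<and> card \<sigma> = Suc (card \<tau>)}.
       (-1) ^ card {x\<in>\<sigma>. x < the_elem (\<sigma> - \<tau>)} * c \<sigma>)"

definition rat_homology_vanishes :: "('v::linorder) set set \<Rightarrow> nat \<Rightarrow> bool" where
  "rat_homology_vanishes K k \<longleftrightarrow>
     (\<forall>c. is_chain K k c \<and> (\<forall>\<tau>. finite \<tau> \<and> card \<tau> = k \<longrightarrow> bdry K c \<tau> = 0) \<longrightarrow>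
        (\<exists>b. is_chain K (Suc k) b \<and>
             (\<forall>\<sigma>. finite \<sigma> \<and> card \<sigma> = Suc k \<longrightarrow> bdry K b \<sigma> = c \<sigma>)))"

end

theory Submission
  imports Defs "HOL-Analysis.Convex" "HOL-Library.FuncSet" "HOL-Real_Asymp.Real_Asymp"
begin

text \<open>
  Garland's method with deterministic weights. A face with \<open>a\<close> minus and \<open>b\<close> plus vertices gets the weight
  \<open>n p\<^sup>a + n p\<^sup>b\<close>, roughly its expected number of extensions. The link graph of a codimension-one face
  consists of two sparse random graphs on sets \<open>A\<close>, \<open>B\<close> joined by an almost complete bipartite graph;
  replacing edge indicators by \<open>p\<close> leaves a form in the two sums over \<open>A\<close> and \<open>B\<close> which is nonpositive
  on weighted-mean-zero functions, so the spectral gap only requires the centred adjacency matrix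
  on \<open>A \<union> B\<close> to be small in operator norm. That follows from Markov's inequality for the trace of a
  sufficiently high fixed power of this matrix. Since \<open>min a b \<le> d\<close> for all faces of dimension at most
  \<open>2 d\<close>, the relevant expectations are at least \<open>n p\<^sup>d = n powr (1 - \<alpha> d)\<close>.
\<close>

section \<open>Garland's method for finite complexes\<close>

lemma fredholm_alternative:
  fixes M :: "'i \<Rightarrow> 'j \<Rightarrow> 'a::field"
  assumes "finite J" "finite I"
    and "\<And>z. (\<forall>j\<in>J. (\<Sum>i\<in>I. z i * M i j) = 0) \<Longrightarrow> (\<Sum>i\<in>I. z i * c i) = 0"
  shows "\<exists>y. \<forall>i\<in>I. (\<Sum>j\<in>J. M i j * y j) = c i"
  using assms(1,3)
proof (induction J arbitrary: c rule: finite_induct)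
  case empty
  have "c i = 0" if "i \<in> I" for i
  proof -
    have "(\<Sum>l\<in>I. (if l = i then 1 else 0) * c l) = 0" by (rule empty) simp
    also have "(\<Sum>l\<in>I. (if l = i then 1 else 0) * c l) = (\<Sum>l\<in>I. if l = i then c l else 0)"
      by (rule sum.cong) auto
    finally show ?thesis using that assms(2) by simp
  qed
  then show ?case by simp
next
  case (insert j0 J)
  define h where "h i = M i j0" for i
  show ?case
  proof (cases "\<forall>z. (\<forall>j\<in>J. (\<Sum>i\<in>I. z i * M i j) = 0) \<longrightarrow> (\<Sum>i\<in>I. z i * c i) = 0")
    case True
    then obtain y where y: "\<forall>i\<in>I. (\<Sum>j\<in>J. M i j * y j) = c i" using insert.IH[of c] by blast
    have "(\<Sum>j\<in>insert j0 J. M i j * (y(j0 := 0)) j) = c i" if "i \<in> I" for i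
    proof -
      have "(\<Sum>j\<in>J. M i j * (y(j0 := 0)) j) = (\<Sum>j\<in>J. M i j * y j)"
        using insert.hyps by (intro sum.cong) auto
      then show ?thesis using y that insert.hyps by simp
    qed
    then show ?thesis by blast
  next
    case False
    then obtain z0 where z0: "\<forall>j\<in>J. (\<Sum>i\<in>I. z0 i * M i j) = 0" "(\<Sum>i\<in>I. z0 i * c i) \<noteq> 0"
      by blast
    have h0: "(\<Sum>i\<in>I. z0 i * h i) \<noteq> 0"
      using insert.prems[of z0] z0 by (auto simp: h_def)
    define t where "t = (\<Sum>i\<in>I. z0 i * c i) / (\<Sum>i\<in>I. z0 i * h i)"
    have "\<exists>y. \<forall>i\<in>I. (\<Sum>j\<in>J. M i j * y j) = c i - t * h i"
    proof (rule insert.IH)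
      fix z assume z: "\<forall>j\<in>J. (\<Sum>i\<in>I. z i * M i j) = 0"
      define s where "s = (\<Sum>i\<in>I. z i * h i) / (\<Sum>i\<in>I. z0 i * h i)"
      have comb: "(\<Sum>i\<in>I. (z i - s * z0 i) * k i) = (\<Sum>i\<in>I. z i * k i) - s * (\<Sum>i\<in>I. z0 i * k i)" for k
        by (simp add: left_diff_distrib sum_subtractf sum_distrib_left mult.assoc)
      have "(\<Sum>i\<in>I. (z i - s * z0 i) * c i) = 0"
        using z z0 h0 comb by (intro insert.prems) (auto simp: s_def h_def)
      then have "(\<Sum>i\<in>I. z i * c i) = t * (\<Sum>i\<in>I. z i * h i)"
        unfolding comb by (simp add: s_def t_def)
      then show "(\<Sum>i\<in>I. z i * (c i - t * h i)) = 0"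
        by (simp add: right_diff_distrib sum_subtractf sum_distrib_left mult.left_commute)
    qed
    then obtain y where y: "\<forall>i\<in>I. (\<Sum>j\<in>J. M i j * y j) = c i - t * h i" by blast
    have "(\<Sum>j\<in>insert j0 J. M i j * (y(j0 := t)) j) = c i" if "i \<in> I" for i
    proof -
      have "(\<Sum>j\<in>J. M i j * (y(j0 := t)) j) = (\<Sum>j\<in>J. M i j * y j)"
        using insert.hyps by (intro sum.cong) auto
      then show ?thesis using y that insert.hyps by (simp add: h_def mult.commute)
    qed
    then show ?thesis by blast
  qed
qed

text \<open>The normal equations \<open>B\<^sup>T W B y = B\<^sup>T W z\<close> always have a solution.\<close>

lemma weighted_least_squares:
  fixes B :: "'i \<Rightarrow> 'j \<Rightarrow> real"
  assumes "finite I" "finite J" "\<And>i. i \<in> I \<Longrightarrow> w i > 0"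
  shows "\<exists>y. \<forall>j\<in>J. (\<Sum>i\<in>I. B i j * (w i * (z i - (\<Sum>l\<in>J. B i l * y l)))) = 0"
proof -
  define M where "M j l = (\<Sum>i\<in>I. w i * B i j * B i l)" for j l
  define c where "c j = (\<Sum>i\<in>I. w i * B i j * z i)" for j
  have "\<exists>y. \<forall>j\<in>J. (\<Sum>l\<in>J. M j l * y l) = c j"
  proof (rule fredholm_alternative[OF assms(2,2)])
    fix u assume u: "\<forall>l\<in>J. (\<Sum>j\<in>J. u j * M j l) = 0"
    define v where "v i = (\<Sum>j\<in>J. B i j * u j)" for i
    have "(\<Sum>l\<in>J. (\<Sum>j\<in>J. u j * M j l) * u l) = (\<Sum>l\<in>J. \<Sum>j\<in>J. \<Sum>i\<in>I. w i * (B i j * u j) * (B i l * u l))"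
      by (simp add: M_def sum_distrib_left sum_distrib_right mult_ac)
    also have "\<dots> = (\<Sum>l\<in>J. \<Sum>i\<in>I. \<Sum>j\<in>J. w i * (B i j * u j) * (B i l * u l))"
      by (intro sum.cong refl sum.swap)
    also have "\<dots> = (\<Sum>i\<in>I. \<Sum>l\<in>J. \<Sum>j\<in>J. w i * (B i j * u j) * (B i l * u l))"
      by (rule sum.swap)
    also have "\<dots> = (\<Sum>i\<in>I. w i * (v i)\<^sup>2)"
      by (simp add: v_def power2_eq_square sum_distrib_left sum_distrib_right mult_ac)
    finally have "(\<Sum>i\<in>I. w i * (v i)\<^sup>2) = 0" using u by simp
    then have "\<forall>i\<in>I. w i * (v i)\<^sup>2 = 0"
      using assms(3) by (subst (asm) sum_nonneg_eq_0_iff[OF assms(1)]) (auto simp: less_imp_le)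
    then have v0: "v i = 0" if "i \<in> I" for i using assms(3)[OF that] that by force
    have "(\<Sum>j\<in>J. u j * c j) = (\<Sum>j\<in>J. \<Sum>i\<in>I. w i * z i * (B i j * u j))"
      by (simp add: c_def sum_distrib_left mult_ac)
    also have "\<dots> = (\<Sum>i\<in>I. w i * z i * v i)"
      unfolding v_def sum_distrib_left by (rule sum.swap)
    finally show "(\<Sum>j\<in>J. u j * c j) = 0" using v0 by simp
  qed
  then obtain y where y: "\<forall>j\<in>J. (\<Sum>l\<in>J. M j l * y l) = c j" by blast
  have "(\<Sum>i\<in>I. B i j * (w i * (z i - (\<Sum>l\<in>J. B i l * y l)))) = c j - (\<Sum>l\<in>J. M j l * y l)" for j
  proof -
    have "(\<Sum>l\<in>J. M j l * y l) = (\<Sum>i\<in>I. \<Sum>l\<in>J. w i * B i j * B i l * y l)"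
      unfolding M_def sum_distrib_right by (rule sum.swap)
    then show ?thesis
      by (simp add: c_def right_diff_distrib sum_subtractf sum_distrib_left mult_ac)
  qed
  then show ?thesis using y by (intro exI[of _ y]) simp
qed

locale finite_complex =
  fixes K :: "'v::linorder set set"
  assumes finite_K: "finite K"
    and finite_face: "\<sigma> \<in> K \<Longrightarrow> finite \<sigma>"
    and face_subset: "\<sigma> \<in> K \<Longrightarrow> \<tau> \<subseteq> \<sigma> \<Longrightarrow> \<tau> \<in> K"
begin

text \<open>Faces are indexed by their number of vertices, i.e. by dimension plus one.\<close>

definition faces :: "nat \<Rightarrow> 'v set set" where
  "faces k = {\<sigma> \<in> K. card \<sigma> = k}"

definition link :: "'v set \<Rightarrow> 'v set" where
  "link \<tau> = {v. v \<notin> \<tau> \<and> insert v \<tau> \<in> K}"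

definition vsign :: "'v set \<Rightarrow> 'v \<Rightarrow> 'a::comm_ring_1" where
  "vsign \<sigma> v = (-1) ^ card {x \<in> \<sigma>. x < v}"

definition inc :: "'v set \<Rightarrow> 'v set \<Rightarrow> 'a::comm_ring_1" where
  "inc \<sigma> \<tau> = (if \<tau> \<subseteq> \<sigma> then vsign \<sigma> (the_elem (\<sigma> - \<tau>)) else 0)"

lemma finite_faces [simp]: "finite (faces k)"
  using finite_K by (simp add: faces_def)

lemma facesD: "\<sigma> \<in> faces k \<Longrightarrow> \<sigma> \<in> K" "\<sigma> \<in> faces k \<Longrightarrow> card \<sigma> = k" "\<sigma> \<in> faces k \<Longrightarrow> finite \<sigma>"
  using finite_face by (auto simp: faces_def)

lemma finite_link [simp]: "finite (link \<tau>)"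
proof -
  have "link \<tau> \<subseteq> \<Union>K" by (auto simp: link_def)
  then show ?thesis using finite_K finite_face by (auto intro: finite_subset)
qed

lemma insert_link_faces: "\<tau> \<in> faces k \<Longrightarrow> v \<in> link \<tau> \<Longrightarrow> insert v \<tau> \<in> faces (Suc k)"
  using finite_face by (auto simp: faces_def link_def)

lemma remove_faces: "\<sigma> \<in> faces (Suc k) \<Longrightarrow> v \<in> \<sigma> \<Longrightarrow> \<sigma> - {v} \<in> faces k"
  by (auto simp: faces_def intro: face_subset)

lemma sum_faces_link:
  "(\<Sum>\<tau>\<in>faces k. \<Sum>v\<in>link \<tau>. h (insert v \<tau>) v) = (\<Sum>\<sigma>\<in>faces (Suc k). \<Sum>v\<in>\<sigma>. h \<sigma> v)"
proof -
  have "(\<Sum>\<tau>\<in>faces k. \<Sum>v\<in>link \<tau>. h (insert v \<tau>) v)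
      = (\<Sum>(\<tau>, v)\<in>Sigma (faces k) link. h (insert v \<tau>) v)"
    by (rule sum.Sigma) auto
  also have "\<dots> = (\<Sum>(\<sigma>, v)\<in>Sigma (faces (Suc k)) (\<lambda>\<sigma>. \<sigma>). h \<sigma> v)"
  proof (rule sum.reindex_bij_witness[where
        i = "\<lambda>(\<sigma>, v). (\<sigma> - {v}, v)" and j = "\<lambda>(\<tau>, v). (insert v \<tau>, v)"], goal_cases)
    case (1 a) then show ?case by (auto simp: link_def)
  next
    case (2 a) then show ?case using insert_link_faces by auto
  next
    case (3 a) then show ?case by auto
  next
    case (4 a)
    then show ?case using remove_faces facesD by (auto simp: link_def insert_absorb)
  next
    case (5 a) then show ?case by auto
  qed
  also have "\<dots> = (\<Sum>\<sigma>\<in>faces (Suc k). \<Sum>v\<in>\<sigma>. h \<sigma> v)"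
    by (rule sum.Sigma[symmetric]) (auto dest: facesD)
  finally show ?thesis .
qed

lemma subfaces_eq: "\<sigma> \<in> faces (Suc k) \<Longrightarrow> {\<tau> \<in> faces k. \<tau> \<subseteq> \<sigma>} = (\<lambda>v. \<sigma> - {v}) ` \<sigma>"
proof (intro equalityI subsetI)
  fix \<tau> assume \<sigma>: "\<sigma> \<in> faces (Suc k)" and "\<tau> \<in> {\<tau> \<in> faces k. \<tau> \<subseteq> \<sigma>}"
  then have \<tau>: "\<tau> \<in> faces k" "\<tau> \<subseteq> \<sigma>" by auto
  have "card (\<sigma> - \<tau>) = 1"
    using \<tau> \<sigma> facesD by (simp add: card_Diff_subset)
  then obtain v where "\<sigma> - \<tau> = {v}" using card_1_singletonE by blast
  then have "v \<in> \<sigma>" "\<tau> = \<sigma> - {v}" using \<tau> by auto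
  then show "\<tau> \<in> (\<lambda>v. \<sigma> - {v}) ` \<sigma>" by auto
qed (auto intro: remove_faces)

lemma superfaces_eq:
  assumes "finite \<tau>" "card \<tau> = k"
  shows "{\<sigma> \<in> faces (Suc k). \<tau> \<subseteq> \<sigma>} = (\<lambda>v. insert v \<tau>) ` link \<tau>"
proof (intro equalityI subsetI)
  fix \<sigma> assume "\<sigma> \<in> {\<sigma> \<in> faces (Suc k). \<tau> \<subseteq> \<sigma>}"
  then have \<sigma>: "\<sigma> \<in> faces (Suc k)" "\<tau> \<subseteq> \<sigma>" by auto
  have "card (\<sigma> - \<tau>) = 1"
    using \<sigma> facesD assms by (simp add: card_Diff_subset)
  then obtain v where "\<sigma> - \<tau> = {v}" using card_1_singletonE by blast
  then have "v \<notin> \<tau>" "\<sigma> = insert v \<tau>" using \<sigma> by auto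
  then show "\<sigma> \<in> (\<lambda>v. insert v \<tau>) ` link \<tau>" using \<sigma> facesD by (auto simp: link_def)
next
  fix \<sigma> assume "\<sigma> \<in> (\<lambda>v. insert v \<tau>) ` link \<tau>"
  then show "\<sigma> \<in> {\<sigma> \<in> faces (Suc k). \<tau> \<subseteq> \<sigma>}"
    using assms by (auto simp: link_def faces_def)
qed

lemma coboundary_eq:
  fixes h :: "'v set \<Rightarrow> 'a::comm_ring_1"
  assumes "\<sigma> \<in> faces (Suc k)"
  shows "(\<Sum>\<tau>\<in>faces k. inc \<sigma> \<tau> * h \<tau>) = (\<Sum>v\<in>\<sigma>. vsign \<sigma> v * h (\<sigma> - {v}))"
proof -
  have "(\<Sum>\<tau>\<in>faces k. inc \<sigma> \<tau> * h \<tau>) = (\<Sum>\<tau>\<in>{\<tau> \<in> faces k. \<tau> \<subseteq> \<sigma>}. inc \<sigma> \<tau> * h \<tau>)"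
    by (rule sum.mono_neutral_right) (auto simp: inc_def)
  also have "\<dots> = (\<Sum>v\<in>\<sigma>. inc \<sigma> (\<sigma> - {v}) * h (\<sigma> - {v}))"
    unfolding subfaces_eq[OF assms] by (subst sum.reindex) (auto simp: inj_on_def)
  also have "\<dots> = (\<Sum>v\<in>\<sigma>. vsign \<sigma> v * h (\<sigma> - {v}))"
  proof (rule sum.cong)
    fix v assume "v \<in> \<sigma>"
    then have "\<sigma> - (\<sigma> - {v}) = {v}" by auto
    then show "inc \<sigma> (\<sigma> - {v}) * h (\<sigma> - {v}) = vsign \<sigma> v * h (\<sigma> - {v})"
      by (auto simp: inc_def)
  qed simp
  finally show ?thesis .
qed

lemma boundary_eq:
  fixes h :: "'v set \<Rightarrow> 'a::comm_ring_1"
  assumes "finite \<tau>" "card \<tau> = k"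
  shows "(\<Sum>\<sigma>\<in>faces (Suc k). inc \<sigma> \<tau> * h \<sigma>)
    = (\<Sum>v\<in>link \<tau>. vsign (insert v \<tau>) v * h (insert v \<tau>))"
proof -
  have "(\<Sum>\<sigma>\<in>faces (Suc k). inc \<sigma> \<tau> * h \<sigma>)
      = (\<Sum>\<sigma>\<in>{\<sigma> \<in> faces (Suc k). \<tau> \<subseteq> \<sigma>}. inc \<sigma> \<tau> * h \<sigma>)"
    by (rule sum.mono_neutral_right) (auto simp: inc_def)
  also have "\<dots> = (\<Sum>v\<in>link \<tau>. inc (insert v \<tau>) \<tau> * h (insert v \<tau>))"
    unfolding superfaces_eq[OF assms] by (subst sum.reindex) (auto simp: inj_on_def link_def)
  also have "\<dots> = (\<Sum>v\<in>link \<tau>. vsign (insert v \<tau>) v * h (insert v \<tau>))"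
  proof (rule sum.cong)
    fix v assume "v \<in> link \<tau>"
    then have "insert v \<tau> - \<tau> = {v}" by (auto simp: link_def)
    then show "inc (insert v \<tau>) \<tau> * h (insert v \<tau>) = vsign (insert v \<tau>) v * h (insert v \<tau>)"
      by (auto simp: inc_def)
  qed simp
  finally show ?thesis .
qed

lemma bdry_eq:
  assumes "finite \<tau>" "card \<tau> = k"
  shows "bdry K c \<tau> = (\<Sum>\<sigma>\<in>faces (Suc k). inc \<sigma> \<tau> * c \<sigma>)"
proof -
  have "(\<Sum>\<sigma>\<in>faces (Suc k). inc \<sigma> \<tau> * c \<sigma>)
      = (\<Sum>\<sigma>\<in>{\<sigma> \<in> faces (Suc k). \<tau> \<subseteq> \<sigma>}. inc \<sigma> \<tau> * c \<sigma>)"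
    by (rule sum.mono_neutral_right) (auto simp: inc_def)
  also have "\<dots> = bdry K c \<tau>"
    unfolding bdry_def using assms finite_face
    by (intro sum.cong) (auto simp: faces_def inc_def vsign_def)
  finally show ?thesis by simp
qed

lemma vsign_square [simp]: "vsign \<sigma> v * vsign \<sigma> v = 1"
  by (simp add: vsign_def flip: power_mult_distrib)

lemma vsign_remove:
  assumes "finite \<rho>" "u \<in> \<rho>" "v \<in> \<rho>" "u \<noteq> v"
  shows "vsign \<rho> u = (if u < v then 1 else -1) * (vsign (\<rho> - {v}) u :: 'a::comm_ring_1)"
proof (cases "u < v")
  case True
  then have "{x \<in> \<rho>. x < u} = {x \<in> \<rho> - {v}. x < u}" by auto
  then show ?thesis using True by (simp add: vsign_def)
next
  case False
  then have "{x \<in> \<rho>. x < u} = insert v {x \<in> \<rho> - {v}. x < u}" using assms by auto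
  then have "card {x \<in> \<rho>. x < u} = Suc (card {x \<in> \<rho> - {v}. x < u})"
    using assms by simp
  then show ?thesis using False by (simp add: vsign_def)
qed

lemma vsign_swap:
  assumes "finite \<rho>" "u \<in> \<rho>" "v \<in> \<rho>" "u \<noteq> v"
  shows "vsign \<rho> u * vsign \<rho> v = - (vsign (\<rho> - {v}) u * vsign (\<rho> - {u}) v :: 'a::comm_ring_1)"
  unfolding vsign_remove[OF assms, where 'a='a]
    vsign_remove[OF assms(1,3,2) assms(4)[symmetric], where 'a='a]
  using assms(4) by (cases "u < v") auto

lemma coboundary_coboundary:
  fixes y :: "'v set \<Rightarrow> real"
  assumes "\<rho> \<in> faces (Suc (Suc k))"
  shows "(\<Sum>\<sigma>\<in>faces (Suc k). inc \<rho> \<sigma> * (\<Sum>\<tau>\<in>faces k. inc \<sigma> \<tau> * y \<tau>)) = 0"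
proof -
  have fin: "finite \<rho>" using assms facesD by auto
  define g where "g v u = vsign \<rho> v * (vsign (\<rho> - {v}) u * y (\<rho> - {v} - {u}))" for u v
  have anti: "g v u = - g u v" if "u \<in> \<rho>" "v \<in> \<rho>" "u \<noteq> v" for u v
  proof -
    have y: "y (\<rho> - {v} - {u}) = y (\<rho> - {u} - {v})" by (rule arg_cong[of _ _ y]) auto
    have "vsign \<rho> v * vsign (\<rho> - {v}) u = - (vsign \<rho> u * (vsign (\<rho> - {u}) v :: real))"
      unfolding vsign_remove[OF fin that, where 'a=real]
        vsign_remove[OF fin that(2,1) that(3)[symmetric], where 'a=real]
      using that(3) by (cases "u < v") (auto simp: mult.commute)
    then show ?thesis unfolding g_def y mult.assoc[symmetric] by simp
  qed
  have "(\<Sum>\<sigma>\<in>faces (Suc k). inc \<rho> \<sigma> * (\<Sum>\<tau>\<in>faces k. inc \<sigma> \<tau> * y \<tau>))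
      = (\<Sum>v\<in>\<rho>. vsign \<rho> v * (\<Sum>\<tau>\<in>faces k. inc (\<rho> - {v}) \<tau> * y \<tau>))"
    by (rule coboundary_eq[OF assms])
  also have "\<dots> = (\<Sum>v\<in>\<rho>. \<Sum>u\<in>\<rho> - {v}. g v u)"
  proof (rule sum.cong[OF refl])
    fix v assume v: "v \<in> \<rho>"
    show "vsign \<rho> v * (\<Sum>\<tau>\<in>faces k. inc (\<rho> - {v}) \<tau> * y \<tau>) = (\<Sum>u\<in>\<rho> - {v}. g v u)"
      unfolding coboundary_eq[OF remove_faces[OF assms v]] by (simp only: g_def sum_distrib_left)
  qed
  also have "\<dots> = (\<Sum>v\<in>\<rho>. \<Sum>u\<in>\<rho>. if u \<noteq> v then g v u else 0)"
  proof (rule sum.cong[OF refl])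
    fix v assume "v \<in> \<rho>"
    show "(\<Sum>u\<in>\<rho> - {v}. g v u) = (\<Sum>u\<in>\<rho>. if u \<noteq> v then g v u else 0)"
      using fin by (intro sum.mono_neutral_cong_left) auto
  qed
  finally have eq: "(\<Sum>\<sigma>\<in>faces (Suc k). inc \<rho> \<sigma> * (\<Sum>\<tau>\<in>faces k. inc \<sigma> \<tau> * y \<tau>))
      = (\<Sum>v\<in>\<rho>. \<Sum>u\<in>\<rho>. if u \<noteq> v then g v u else 0)" (is "?S = ?D") .
  have "?D = (\<Sum>v\<in>\<rho>. \<Sum>u\<in>\<rho>. if v \<noteq> u then g u v else 0)" by (rule sum.swap)
  also have "\<dots> = (\<Sum>v\<in>\<rho>. \<Sum>u\<in>\<rho>. - (if u \<noteq> v then g v u else 0))"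
  proof (rule sum.cong[OF refl], rule sum.cong[OF refl])
    fix u v assume "v \<in> \<rho>" "u \<in> \<rho>"
    then show "(if v \<noteq> u then g u v else 0) = - (if u \<noteq> v then g v u else 0)"
      using anti[of v u] by (cases "u = v") simp_all
  qed
  also have "\<dots> = - ?D" by (simp add: sum_negf)
  finally show ?thesis using eq by simp
qed

lemma coboundary_norm:
  fixes x :: "'v set \<Rightarrow> real"
  shows "(\<Sum>\<rho>\<in>faces (Suc (Suc k)). (\<Sum>\<sigma>\<in>faces (Suc k). inc \<rho> \<sigma> * x \<sigma>)\<^sup>2)
    = (\<Sum>\<sigma>\<in>faces (Suc k). real (card (link \<sigma>)) * (x \<sigma>)\<^sup>2)
      - (\<Sum>\<tau>\<in>faces k. \<Sum>u\<in>link \<tau>. \<Sum>v\<in>link (insert u \<tau>).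
          (vsign (insert u \<tau>) u * x (insert u \<tau>)) * (vsign (insert v \<tau>) v * x (insert v \<tau>)))"
    (is "?L = ?A - ?B")
proof -
  define g where "g \<rho> v u = - (vsign (\<rho> - {u}) v * x (\<rho> - {u})) * (vsign (\<rho> - {v}) u * x (\<rho> - {v}))" for \<rho> u v
  have sq: "(\<Sum>\<sigma>\<in>faces (Suc k). inc \<rho> \<sigma> * x \<sigma>)\<^sup>2
      = (\<Sum>v\<in>\<rho>. (x (\<rho> - {v}))\<^sup>2) + (\<Sum>v\<in>\<rho>. \<Sum>u\<in>\<rho> - {v}. g \<rho> v u)"
    if \<rho>: "\<rho> \<in> faces (Suc (Suc k))" for \<rho>
  proof -
    have fin: "finite \<rho>" using \<rho> facesD by auto
    have "(\<Sum>\<sigma>\<in>faces (Suc k). inc \<rho> \<sigma> * x \<sigma>)\<^sup>2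
      = (\<Sum>v\<in>\<rho>. \<Sum>u\<in>\<rho>. (vsign \<rho> v * x (\<rho> - {v})) * (vsign \<rho> u * x (\<rho> - {u})))"
      unfolding coboundary_eq[OF \<rho>] power2_eq_square sum_product ..
    also have "\<dots> = (\<Sum>v\<in>\<rho>. (x (\<rho> - {v}))\<^sup>2 + (\<Sum>u\<in>\<rho> - {v}. g \<rho> v u))"
    proof (rule sum.cong)
      fix v assume v: "v \<in> \<rho>"
      have "(\<Sum>u\<in>\<rho>. (vsign \<rho> v * x (\<rho> - {v})) * (vsign \<rho> u * x (\<rho> - {u})))
        = (vsign \<rho> v * vsign \<rho> v) * (x (\<rho> - {v}))\<^sup>2
          + (\<Sum>u\<in>\<rho> - {v}. (vsign \<rho> v * vsign \<rho> u) * (x (\<rho> - {v}) * x (\<rho> - {u})))"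
        using v fin by (subst sum.remove[of _ v]) (auto simp: power2_eq_square mult_ac)
      also have "(\<Sum>u\<in>\<rho> - {v}. (vsign \<rho> v * vsign \<rho> u) * (x (\<rho> - {v}) * x (\<rho> - {u})))
        = (\<Sum>u\<in>\<rho> - {v}. g \<rho> v u)"
      proof (rule sum.cong)
        fix u assume u: "u \<in> \<rho> - {v}"
        show "(vsign \<rho> v * vsign \<rho> u) * (x (\<rho> - {v}) * x (\<rho> - {u})) = g \<rho> v u"
          using vsign_swap[OF fin v, of u, where 'a=real] u by (auto simp: g_def)
      qed simp
      finally show "(\<Sum>u\<in>\<rho>. (vsign \<rho> v * x (\<rho> - {v})) * (vsign \<rho> u * x (\<rho> - {u})))
        = (x (\<rho> - {v}))\<^sup>2 + (\<Sum>u\<in>\<rho> - {v}. g \<rho> v u)" by simp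
    qed simp
    finally show ?thesis by (simp add: sum.distrib)
  qed
  have "?L = (\<Sum>\<rho>\<in>faces (Suc (Suc k)). \<Sum>v\<in>\<rho>. (x (\<rho> - {v}))\<^sup>2)
      + (\<Sum>\<rho>\<in>faces (Suc (Suc k)). \<Sum>v\<in>\<rho>. \<Sum>u\<in>\<rho> - {v}. g \<rho> v u)"
    by (simp add: sq sum.distrib)
  also have "(\<Sum>\<rho>\<in>faces (Suc (Suc k)). \<Sum>v\<in>\<rho>. (x (\<rho> - {v}))\<^sup>2)
      = (\<Sum>\<sigma>\<in>faces (Suc k). \<Sum>v\<in>link \<sigma>. (x (insert v \<sigma> - {v}))\<^sup>2)"
    by (rule sum_faces_link[symmetric])
  also have "\<dots> = ?A"
  proof (rule sum.cong)
    fix \<sigma> 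
    have "(\<Sum>v\<in>link \<sigma>. (x (insert v \<sigma> - {v}))\<^sup>2) = (\<Sum>v\<in>link \<sigma>. (x \<sigma>)\<^sup>2)"
      by (intro sum.cong) (auto simp: link_def)
    then show "(\<Sum>v\<in>link \<sigma>. (x (insert v \<sigma> - {v}))\<^sup>2) = real (card (link \<sigma>)) * (x \<sigma>)\<^sup>2"
      by simp
  qed simp
  also have "(\<Sum>\<rho>\<in>faces (Suc (Suc k)). \<Sum>v\<in>\<rho>. \<Sum>u\<in>\<rho> - {v}. g \<rho> v u)
      = (\<Sum>\<sigma>\<in>faces (Suc k). \<Sum>v\<in>link \<sigma>. \<Sum>u\<in>insert v \<sigma> - {v}. g (insert v \<sigma>) v u)"
    by (rule sum_faces_link[symmetric])
  also have "\<dots> = (\<Sum>\<sigma>\<in>faces (Suc k). \<Sum>v\<in>link \<sigma>. \<Sum>u\<in>\<sigma>. g (insert v \<sigma>) v u)"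
    by (intro sum.cong) (auto simp: link_def)
  also have "\<dots> = (\<Sum>\<sigma>\<in>faces (Suc k). \<Sum>u\<in>\<sigma>. \<Sum>v\<in>link \<sigma>. g (insert v \<sigma>) v u)"
    by (intro sum.cong sum.swap refl)
  also have "\<dots> = (\<Sum>\<tau>\<in>faces k. \<Sum>u\<in>link \<tau>. \<Sum>v\<in>link (insert u \<tau>). g (insert v (insert u \<tau>)) v u)"
    by (rule sum_faces_link[symmetric])
  also have "\<dots> = - ?B"
  proof -
    have "g (insert v (insert u \<tau>)) v u
        = - ((vsign (insert u \<tau>) u * x (insert u \<tau>)) * (vsign (insert v \<tau>) v * x (insert v \<tau>)))"
      if "u \<in> link \<tau>" "v \<in> link (insert u \<tau>)" for u v \<tau>
    proof -
      have "insert v (insert u \<tau>) - {v} = insert u \<tau>" "insert v (insert u \<tau>) - {u} = insert v \<tau>"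
        using that by (auto simp: link_def)
      then show ?thesis by (simp add: g_def)
    qed
    then show ?thesis by (simp add: sum_negf)
  qed
  finally show ?thesis by simp
qed

lemma garland_harmonic_zero:
  fixes x m :: "'v set \<Rightarrow> real"
  assumes gap: "\<And>\<tau> f. \<tau> \<in> faces k \<Longrightarrow> (\<Sum>v\<in>link \<tau>. m (insert v \<tau>) * f v) = 0 \<Longrightarrow>
      (\<Sum>u\<in>link \<tau>. \<Sum>v\<in>link (insert u \<tau>). f u * f v) \<le> \<mu> * (\<Sum>v\<in>link \<tau>. m (insert v \<tau>) * (f v)\<^sup>2)"
    and deg: "\<And>\<sigma>. \<sigma> \<in> faces (Suc k) \<Longrightarrow> \<mu> * real (Suc k) * m \<sigma> < real (card (link \<sigma>))"
    and cocycle: "\<And>\<rho>. \<rho> \<in> faces (Suc (Suc k)) \<Longrightarrow> (\<Sum>\<sigma>\<in>faces (Suc k). inc \<rho> \<sigma> * x \<sigma>) = 0"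
    and cycle: "\<And>\<tau>. \<tau> \<in> faces k \<Longrightarrow> (\<Sum>\<sigma>\<in>faces (Suc k). inc \<sigma> \<tau> * (m \<sigma> * x \<sigma>)) = 0"
    and \<sigma>: "\<sigma> \<in> faces (Suc k)"
  shows "x \<sigma> = 0"
proof -
  define f where "f \<tau> v = vsign (insert v \<tau>) v * x (insert v \<tau>)" for \<tau> v
  have "(\<Sum>\<sigma>\<in>faces (Suc k). real (card (link \<sigma>)) * (x \<sigma>)\<^sup>2)
      = (\<Sum>\<tau>\<in>faces k. \<Sum>u\<in>link \<tau>. \<Sum>v\<in>link (insert u \<tau>). f \<tau> u * f \<tau> v)"
    using coboundary_norm[where k=k and x=x] by (simp add: cocycle f_def)
  also have "\<dots> \<le> (\<Sum>\<tau>\<in>faces k. \<mu> * (\<Sum>v\<in>link \<tau>. m (insert v \<tau>) * (f \<tau> v)\<^sup>2))"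
  proof (intro sum_mono gap)
    fix \<tau> assume \<tau>: "\<tau> \<in> faces k"
    have "(\<Sum>v\<in>link \<tau>. m (insert v \<tau>) * f \<tau> v) = (\<Sum>\<sigma>\<in>faces (Suc k). inc \<sigma> \<tau> * (m \<sigma> * x \<sigma>))"
      using boundary_eq[of \<tau> k "\<lambda>\<sigma>. m \<sigma> * x \<sigma>"] facesD[OF \<tau>] by (simp add: f_def mult_ac)
    then show "(\<Sum>v\<in>link \<tau>. m (insert v \<tau>) * f \<tau> v) = 0" using cycle[OF \<tau>] by simp
  qed
  also have "\<dots> = \<mu> * (\<Sum>\<tau>\<in>faces k. \<Sum>v\<in>link \<tau>. m (insert v \<tau>) * (x (insert v \<tau>))\<^sup>2)"
    by (simp add: f_def power_mult_distrib sum_distrib_left power2_eq_square[of "vsign _ _"])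
  also have "\<dots> = \<mu> * (\<Sum>\<sigma>\<in>faces (Suc k). \<Sum>v\<in>\<sigma>. m \<sigma> * (x \<sigma>)\<^sup>2)"
    by (simp add: sum_faces_link[of "\<lambda>\<sigma> v. m \<sigma> * (x \<sigma>)\<^sup>2"])
  also have "\<dots> = (\<Sum>\<sigma>\<in>faces (Suc k). \<mu> * real (Suc k) * m \<sigma> * (x \<sigma>)\<^sup>2)"
    unfolding sum_distrib_left by (intro sum.cong) (auto dest: facesD(2))
  finally have le: "(\<Sum>\<sigma>\<in>faces (Suc k). (real (card (link \<sigma>)) - \<mu> * real (Suc k) * m \<sigma>) * (x \<sigma>)\<^sup>2) \<le> 0"
    by (simp add: left_diff_distrib sum_subtractf)
  have nn: "(real (card (link \<sigma>)) - \<mu> * real (Suc k) * m \<sigma>) * (x \<sigma>)\<^sup>2 \<ge> 0" if "\<sigma> \<in> faces (Suc k)" for \<sigma>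
    using deg[OF that] by (intro mult_nonneg_nonneg) auto
  then have "(\<Sum>\<sigma>\<in>faces (Suc k). (real (card (link \<sigma>)) - \<mu> * real (Suc k) * m \<sigma>) * (x \<sigma>)\<^sup>2) = 0"
    using le by (intro antisym sum_nonneg) auto
  then have "(real (card (link \<sigma>)) - \<mu> * real (Suc k) * m \<sigma>) * (x \<sigma>)\<^sup>2 = 0"
    using nn \<sigma> by (subst (asm) sum_nonneg_eq_0_iff) auto
  then show ?thesis using deg[OF \<sigma>] by simp
qed

theorem garland_vanishing:
  fixes m :: "'v set \<Rightarrow> real"
  assumes pos: "\<And>\<sigma>. \<sigma> \<in> faces (Suc k) \<Longrightarrow> m \<sigma> > 0"
    and gap: "\<And>\<tau> f. \<tau> \<in> faces k \<Longrightarrow> (\<Sum>v\<in>link \<tau>. m (insert v \<tau>) * f v) = 0 \<Longrightarrow>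
      (\<Sum>u\<in>link \<tau>. \<Sum>v\<in>link (insert u \<tau>). f u * f v) \<le> \<mu> * (\<Sum>v\<in>link \<tau>. m (insert v \<tau>) * (f v)\<^sup>2)"
    and deg: "\<And>\<sigma>. \<sigma> \<in> faces (Suc k) \<Longrightarrow> \<mu> * real (Suc k) * m \<sigma> < real (card (link \<sigma>))"
  shows "rat_homology_vanishes K k"
  unfolding rat_homology_vanishes_def
proof (intro allI impI)
  fix c assume "is_chain K k c \<and> (\<forall>\<tau>. finite \<tau> \<and> card \<tau> = k \<longrightarrow> bdry K c \<tau> = 0)"
  then have chain: "is_chain K k c" and cyc: "\<And>\<tau>. finite \<tau> \<Longrightarrow> card \<tau> = k \<Longrightarrow> bdry K c \<tau> = 0" by auto
  have "\<exists>y. \<forall>\<sigma>\<in>faces (Suc k). (\<Sum>\<rho>\<in>faces (Suc (Suc k)). inc \<rho> \<sigma> * y \<rho>) = c \<sigma>"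
  proof (rule fredholm_alternative)
    fix z assume z: "\<forall>\<rho>\<in>faces (Suc (Suc k)). (\<Sum>\<sigma>\<in>faces (Suc k). z \<sigma> * inc \<rho> \<sigma>) = (0::rat)"
    let ?z = "\<lambda>\<sigma>. real_of_rat (z \<sigma>)"
    have inc_rat: "real_of_rat (inc \<rho> \<sigma>) = inc \<rho> \<sigma>" for \<rho> \<sigma> :: "'v set"
      by (simp add: inc_def vsign_def of_rat_power of_rat_minus)
    obtain y where y: "\<forall>\<tau>\<in>faces k. (\<Sum>\<sigma>\<in>faces (Suc k).
        inc \<sigma> \<tau> * (m \<sigma> * (?z \<sigma> - (\<Sum>\<tau>\<in>faces k. inc \<sigma> \<tau> * y \<tau>)))) = 0"
      using weighted_least_squares[of "faces (Suc k)" "faces k" m inc ?z] pos by auto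
    define x where "x \<sigma> = ?z \<sigma> - (\<Sum>\<tau>\<in>faces k. inc \<sigma> \<tau> * y \<tau>)" for \<sigma>
    have "x \<sigma> = 0" if "\<sigma> \<in> faces (Suc k)" for \<sigma>
    proof (rule garland_harmonic_zero[OF gap deg _ _ that])
      fix \<rho> assume \<rho>: "\<rho> \<in> faces (Suc (Suc k))"
      have "(\<Sum>\<sigma>\<in>faces (Suc k). inc \<rho> \<sigma> * ?z \<sigma>) = real_of_rat (\<Sum>\<sigma>\<in>faces (Suc k). z \<sigma> * inc \<rho> \<sigma>)"
        by (simp add: of_rat_sum of_rat_mult inc_rat mult.commute)
      then show "(\<Sum>\<sigma>\<in>faces (Suc k). inc \<rho> \<sigma> * x \<sigma>) = 0"
        using z \<rho> coboundary_coboundary[OF \<rho>, of y]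
        by (simp add: x_def right_diff_distrib sum_subtractf)
    qed (use y in \<open>auto simp: x_def\<close>)
    then have zy: "?z \<sigma> = (\<Sum>\<tau>\<in>faces k. inc \<sigma> \<tau> * y \<tau>)" if "\<sigma> \<in> faces (Suc k)" for \<sigma>
      using that by (simp add: x_def)
    have "real_of_rat (\<Sum>\<sigma>\<in>faces (Suc k). z \<sigma> * c \<sigma>)
        = (\<Sum>\<sigma>\<in>faces (Suc k). \<Sum>\<tau>\<in>faces k. inc \<sigma> \<tau> * y \<tau> * real_of_rat (c \<sigma>))"
      by (simp add: of_rat_sum of_rat_mult zy sum_distrib_right)
    also have "\<dots> = (\<Sum>\<tau>\<in>faces k. \<Sum>\<sigma>\<in>faces (Suc k). inc \<sigma> \<tau> * y \<tau> * real_of_rat (c \<sigma>))"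
      by (rule sum.swap)
    also have "\<dots> = (\<Sum>\<tau>\<in>faces k. y \<tau> * real_of_rat (\<Sum>\<sigma>\<in>faces (Suc k). inc \<sigma> \<tau> * c \<sigma>))"
      by (simp add: of_rat_sum of_rat_mult inc_rat sum_distrib_left mult_ac)
    also have "\<dots> = 0"
      using cyc facesD by (intro sum.neutral) (auto simp: bdry_eq[symmetric])
    finally show "(\<Sum>\<sigma>\<in>faces (Suc k). z \<sigma> * c \<sigma>) = 0" by simp
  qed auto
  then obtain y where y: "\<forall>\<sigma>\<in>faces (Suc k). (\<Sum>\<rho>\<in>faces (Suc (Suc k)). inc \<rho> \<sigma> * y \<rho>) = c \<sigma>" by blast
  define b where "b \<rho> = (if \<rho> \<in> faces (Suc (Suc k)) then y \<rho> else 0)" for \<rho>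
  show "\<exists>b. is_chain K (Suc k) b \<and> (\<forall>\<sigma>. finite \<sigma> \<and> card \<sigma> = Suc k \<longrightarrow> bdry K b \<sigma> = c \<sigma>)"
  proof (intro exI[of _ b] conjI allI impI)
    show "is_chain K (Suc k) b" using facesD by (auto simp: is_chain_def b_def)
    fix \<sigma> :: "'v set" assume \<sigma>: "finite \<sigma> \<and> card \<sigma> = Suc k"
    have eq: "bdry K b \<sigma> = (\<Sum>\<rho>\<in>faces (Suc (Suc k)). inc \<rho> \<sigma> * y \<rho>)"
      using \<sigma> by (simp add: bdry_eq b_def)
    show "bdry K b \<sigma> = c \<sigma>"
    proof (cases "\<sigma> \<in> K")
      case True
      then show ?thesis using y \<sigma> eq by (simp add: faces_def)
    next
      case False
      then have "c \<sigma> = 0" using chain by (auto simp: is_chain_def)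
      moreover have "inc \<rho> \<sigma> = (0::rat)" if "\<rho> \<in> faces (Suc (Suc k))" for \<rho>
        using False face_subset[OF facesD(1)[OF that]] by (auto simp: inc_def)
      ultimately show ?thesis using eq by simp
    qed
  qed
qed

end

section \<open>The complex of a graph\<close>

definition sface :: "nat set \<Rightarrow> nat set \<Rightarrow> (nat \<times> int) set" where
  "sface \<sigma> \<tau> = \<sigma> \<times> {-1} \<union> \<tau> \<times> {1}"

definition ext :: "nat \<Rightarrow> nat set set \<Rightarrow> nat set \<Rightarrow> nat set \<Rightarrow> nat set" where
  "ext n E \<sigma> \<tau> = {v \<in> {1..n} - \<sigma> - \<tau>. (\<forall>s\<in>\<sigma>. {v, s} \<in> E) \<and> (\<forall>t\<in>\<tau>. {v, t} \<notin> E)}"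

definition noise :: "real \<Rightarrow> nat set set \<Rightarrow> nat \<Rightarrow> nat \<Rightarrow> real" where
  "noise p E u v = (if u = v then 0 else of_bool ({u, v} \<in> E) - p)"

definition sweight :: "nat \<Rightarrow> real \<Rightarrow> (nat \<times> int) set \<Rightarrow> real" where
  "sweight n p F = real n * (p ^ card {v. (v, -1) \<in> F} + p ^ card {v. (v, 1) \<in> F})"

lemma finite_ext [simp]: "finite (ext n E \<sigma> \<tau>)"
  by (simp add: ext_def)

lemma sface_mem [simp]: "(v, -1) \<in> sface \<sigma> \<tau> \<longleftrightarrow> v \<in> \<sigma>" "(v, 1) \<in> sface \<sigma> \<tau> \<longleftrightarrow> v \<in> \<tau>"
  by (auto simp: sface_def)

lemma sface_eq_iff [simp]: "sface \<sigma> \<tau> = sface \<sigma>' \<tau>' \<longleftrightarrow> \<sigma> = \<sigma>' \<and> \<tau> = \<tau>'"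
  by (metis sface_mem subsetI subset_antisym)

lemma card_sface: "finite \<sigma> \<Longrightarrow> finite \<tau> \<Longrightarrow> card (sface \<sigma> \<tau>) = card \<sigma> + card \<tau>"
  unfolding sface_def by (subst card_Un_disjoint) (auto simp: card_cartesian_product)

lemma sum_sface:
  "finite \<sigma> \<Longrightarrow> finite \<tau> \<Longrightarrow> (\<Sum>x\<in>sface \<sigma> \<tau>. h x) = (\<Sum>v\<in>\<sigma>. h (v, -1)) + (\<Sum>v\<in>\<tau>. h (v, 1))"
  for h :: "nat \<times> int \<Rightarrow> real"
proof -
  assume fin: "finite \<sigma>" "finite \<tau>"
  have "sface \<sigma> \<tau> = (\<lambda>v. (v, -1)) ` \<sigma> \<union> (\<lambda>v. (v, 1)) ` \<tau>" by (auto simp: sface_def)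
  moreover have "(\<Sum>x\<in>(\<lambda>v. (v, -1)) ` \<sigma> \<union> (\<lambda>v. (v, 1)) ` \<tau>. h x)
      = (\<Sum>x\<in>(\<lambda>v. (v, -1)) ` \<sigma>. h x) + (\<Sum>x\<in>(\<lambda>v. (v, 1)) ` \<tau>. h x)"
    using fin by (intro sum.union_disjoint) auto
  ultimately show ?thesis by (simp add: sum.reindex inj_on_def)
qed

lemma insert_sface: "insert (v, -1) (sface \<sigma> \<tau>) = sface (insert v \<sigma>) \<tau>"
  "insert (v, 1) (sface \<sigma> \<tau>) = sface \<sigma> (insert v \<tau>)"
  by (auto simp: sface_def)

lemma sweight_sface [simp]: "sweight n p (sface \<sigma> \<tau>) = real n * (p ^ card \<sigma> + p ^ card \<tau>)"
  by (simp add: sweight_def)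

lemma Ztilde_iff:
  "sface \<sigma> \<tau> \<in> Ztilde n E \<longleftrightarrow> is_clique n E \<sigma> \<and> is_clique n E \<tau> \<and> \<sigma> \<inter> \<tau> = {} \<and>
      (\<forall>x\<in>\<sigma>. \<forall>y\<in>\<tau>. {x, y} \<notin> E)"
proof -
  have "sface \<sigma> \<tau> \<in> Ztilde n E \<longleftrightarrow> (\<exists>\<sigma>' \<tau>'. sface \<sigma> \<tau> = sface \<sigma>' \<tau>' \<and> is_clique n E \<sigma>' \<and> is_clique n E \<tau>' \<and> \<sigma>' \<inter> \<tau>' = {} \<and>
      (\<forall>x\<in>\<sigma>'. \<forall>y\<in>\<tau>'. {x, y} \<notin> E))"
    unfolding Ztilde_def sface_def by blast
  then show ?thesis by auto
qed

lemma ZtildeE: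
  assumes "F \<in> Ztilde n E"
  obtains \<sigma> \<tau> where "F = sface \<sigma> \<tau>" "sface \<sigma> \<tau> \<in> Ztilde n E" "\<sigma> \<subseteq> {1..n}" "\<tau> \<subseteq> {1..n}" "\<sigma> \<inter> \<tau> = {}"
proof -
  from assms obtain \<sigma> \<tau> where F: "F = sface \<sigma> \<tau>" unfolding Ztilde_def sface_def by blast
  then show thesis using that assms by (auto simp: Ztilde_iff is_clique_def)
qed

lemma Ztilde_link_minus:
  assumes "sface \<sigma> \<tau> \<in> Ztilde n E"
  shows "v \<notin> \<sigma> \<and> sface (insert v \<sigma>) \<tau> \<in> Ztilde n E \<longleftrightarrow> v \<in> ext n E \<sigma> \<tau>"
  using assms by (auto simp: Ztilde_iff is_clique_def ext_def insert_commute)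

lemma Ztilde_link_plus:
  assumes "sface \<sigma> \<tau> \<in> Ztilde n E"
  shows "v \<notin> \<tau> \<and> sface \<sigma> (insert v \<tau>) \<in> Ztilde n E \<longleftrightarrow> v \<in> ext n E \<tau> \<sigma>"
  using assms by (auto simp: Ztilde_iff is_clique_def ext_def insert_commute)

lemma finite_complex_Ztilde: "finite_complex (Ztilde n E)"
proof
  have "Ztilde n E \<subseteq> Pow ({1..n} \<times> {-1, 1})"
    by (auto simp: Ztilde_def is_clique_def)
  then show "finite (Ztilde n E)" by (rule finite_subset) simp
  fix F assume F: "F \<in> Ztilde n E"
  then obtain \<sigma> \<tau> where st: "F = sface \<sigma> \<tau>" "\<sigma> \<subseteq> {1..n}" "\<tau> \<subseteq> {1..n}" by (rule ZtildeE) auto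
  then show "finite F" by (auto simp: sface_def intro: finite_subset)
  fix G assume G: "G \<subseteq> F"
  have "G = sface {v. (v, -1) \<in> G} {v. (v, 1) \<in> G}"
    using G st(1) by (auto simp: sface_def)
  moreover have "{v. (v, -1) \<in> G} \<subseteq> \<sigma>" "{v. (v, 1) \<in> G} \<subseteq> \<tau>"
    using G st(1) by auto
  then have "sface {v. (v, -1) \<in> G} {v. (v, 1) \<in> G} \<in> Ztilde n E"
    using F unfolding st(1) Ztilde_iff is_clique_def by blast
  ultimately show "G \<in> Ztilde n E" by simp
qed

lemma Ztilde_link:
  assumes "sface \<sigma> \<tau> \<in> Ztilde n E"
  shows "finite_complex.link (Ztilde n E) (sface \<sigma> \<tau>) = sface (ext n E \<sigma> \<tau>) (ext n E \<tau> \<sigma>)"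
proof -
  interpret finite_complex "Ztilde n E" by (rule finite_complex_Ztilde)
  have sgn: "s = -1 \<or> s = 1" if "insert (v, s) (sface \<sigma> \<tau>) \<in> Ztilde n E" for v s
    by (rule ZtildeE[OF that]) (auto simp: sface_def)
  have "(v, s) \<in> link (sface \<sigma> \<tau>) \<longleftrightarrow> (v, s) \<in> sface (ext n E \<sigma> \<tau>) (ext n E \<tau> \<sigma>)" for v s
  proof (cases "s = -1 \<or> s = 1")
    case True
    then show ?thesis
      using Ztilde_link_minus[OF assms, of v] Ztilde_link_plus[OF assms, of v]
      by (auto simp: link_def insert_sface)
  next
    case False
    then show ?thesis using sgn by (auto simp: link_def sface_def)
  qed
  then show ?thesis by auto
qed

lemma ext_insert_left:
  "u \<in> ext n E \<sigma> \<tau> \<Longrightarrow> ext n E (insert u \<sigma>) \<tau> = {v \<in> ext n E \<sigma> \<tau>. v \<noteq> u \<and> {u, v} \<in> E}"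
  by (auto simp: ext_def insert_commute)

lemma ext_insert_right:
  "ext n E \<tau> (insert u \<sigma>) = {v \<in> ext n E \<tau> \<sigma>. v \<noteq> u \<and> {u, v} \<notin> E}"
  by (auto simp: ext_def insert_commute)

text \<open>After division by \<open>p ^ b\<close> the constraint reads \<open>(1 + p s) x = - (s + p) y\<close> with \<open>s = p ^ (a - b)\<close>.\<close>

lemma mean_part_nonpos_aux:
  fixes p x y :: real
  assumes p: "0 < p" "p \<le> 1/3" and ab: "b \<le> a"
    and con: "(p ^ Suc a + p ^ b) * x + (p ^ a + p ^ Suc b) * y = 0"
  shows "p * x\<^sup>2 + p * y\<^sup>2 + 2 * (1 - p) * (x * y) \<le> 0"
proof -
  define s where "s = p ^ (a - b)"
  define t where "t = s + p"
  define D where "D = 1 + p * s"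
  have s: "0 < s" "s \<le> 1" using p by (auto simp: s_def power_le_one)
  have pa: "p ^ a = p ^ b * s" using ab by (simp add: s_def flip: power_add)
  have "p ^ b * (D * x + t * y) = 0"
    using con by (simp add: pa D_def t_def algebra_simps)
  then have eq: "D * x = - t * y" using p by simp
  have D: "D > 0" "t > 0" using p s by (auto simp: D_def t_def add_pos_pos)
  have "D - t = (1 - s) * (1 - p)" by (simp add: D_def t_def algebra_simps)
  moreover have "0 \<le> (1 - s) * (1 - p)" using s p by simp
  ultimately have tD: "t \<le> D" by simp
  have "t - p * D = s * (1 - p * p)" by (simp add: D_def t_def algebra_simps)
  moreover have "p * p \<le> 1" using p mult_mono[of p 1 p 1] by simp
  then have "0 \<le> s * (1 - p * p)" using s by simp
  ultimately have pD: "p * D \<le> t" by simp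
  have "D\<^sup>2 * (p * x\<^sup>2 + p * y\<^sup>2 + 2 * (1 - p) * (x * y))
      = p * (D * x)\<^sup>2 + p * (D * y)\<^sup>2 + 2 * (1 - p) * ((D * x) * (D * y))"
    by (simp add: power2_eq_square algebra_simps)
  also have "\<dots> = y\<^sup>2 * (p * t\<^sup>2 + p * D\<^sup>2 - 2 * (1 - p) * (t * D))"
    unfolding eq by (simp add: power2_eq_square algebra_simps)
  also have "\<dots> \<le> 0"
  proof -
    have "p * t\<^sup>2 \<le> p * (t * D)" using tD D p by (simp add: power2_eq_square)
    moreover have "p * D\<^sup>2 \<le> t * D" using pD D by (simp add: power2_eq_square flip: mult.assoc)
    moreover have "(3 * p) * (t * D) \<le> 1 * (t * D)" using p D by (intro mult_right_mono) auto
    ultimately have "p * t\<^sup>2 + p * D\<^sup>2 - 2 * (1 - p) * (t * D) \<le> 0" by (simp add: algebra_simps)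
    then show ?thesis by (simp add: mult_nonneg_nonpos)
  qed
  finally show ?thesis using D by (simp add: mult_le_0_iff)
qed

lemma mean_part_nonpos:
  fixes p x y :: real
  assumes "0 < p" "p \<le> 1/3"
    and "(p ^ Suc a + p ^ b) * x + (p ^ a + p ^ Suc b) * y = 0"
  shows "p * x\<^sup>2 + p * y\<^sup>2 + 2 * (1 - p) * (x * y) \<le> 0"
proof (cases "b \<le> a")
  case True
  then show ?thesis using mean_part_nonpos_aux assms by blast
next
  case False
  have "p * y\<^sup>2 + p * x\<^sup>2 + 2 * (1 - p) * (y * x) \<le> 0"
    using False assms by (intro mean_part_nonpos_aux[of p a b]) (auto simp: algebra_simps)
  then show ?thesis by (simp add: algebra_simps)
qed

lemma sum_adjacent:
  fixes h :: "nat \<Rightarrow> real"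
  assumes "finite A"
  shows "(\<Sum>u\<in>A. \<Sum>v\<in>{v \<in> A. v \<noteq> u \<and> {u, v} \<in> E}. h u * h v)
    = p * (\<Sum>v\<in>A. h v)\<^sup>2 - p * (\<Sum>v\<in>A. (h v)\<^sup>2) + (\<Sum>u\<in>A. \<Sum>v\<in>A. noise p E u v * (h u * h v))"
    (is "?L = _")
proof -
  have "?L = (\<Sum>u\<in>A. \<Sum>v\<in>A. if v \<noteq> u \<and> {u, v} \<in> E then h u * h v else 0)"
    using assms by (simp add: sum.inter_filter)
  also have "\<dots> = (\<Sum>u\<in>A. \<Sum>v\<in>A. (p * (h u * h v) - (if v = u then p * (h v)\<^sup>2 else 0)) + noise p E u v * (h u * h v))"
    by (intro sum.cong refl) (auto simp: noise_def power2_eq_square algebra_simps)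
  also have "\<dots> = p * (\<Sum>u\<in>A. \<Sum>v\<in>A. h u * h v) - p * (\<Sum>v\<in>A. (h v)\<^sup>2) + (\<Sum>u\<in>A. \<Sum>v\<in>A. noise p E u v * (h u * h v))"
    using assms by (simp add: sum.distrib sum_subtractf sum_distrib_left sum.delta)
  also have "(\<Sum>u\<in>A. \<Sum>v\<in>A. h u * h v) = (\<Sum>v\<in>A. h v)\<^sup>2"
    by (simp add: power2_eq_square sum_product)
  finally show ?thesis .
qed

lemma sum_nonadjacent:
  fixes h :: "nat \<Rightarrow> real"
  assumes "finite A" "finite B" "A \<inter> B = {}"
  shows "(\<Sum>u\<in>A. \<Sum>v\<in>{v \<in> B. v \<noteq> u \<and> {u, v} \<notin> E}. h u * h' v)
    = (1 - p) * ((\<Sum>u\<in>A. h u) * (\<Sum>v\<in>B. h' v)) - (\<Sum>u\<in>A. \<Sum>v\<in>B. noise p E u v * (h u * h' v))"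
    (is "?L = _")
proof -
  have "?L = (\<Sum>u\<in>A. \<Sum>v\<in>B. if v \<noteq> u \<and> {u, v} \<notin> E then h u * h' v else 0)"
    using assms by (simp add: sum.inter_filter)
  also have "\<dots> = (\<Sum>u\<in>A. \<Sum>v\<in>B. (1 - p) * (h u * h' v) - noise p E u v * (h u * h' v))"
    using assms(3) by (intro sum.cong refl) (auto simp: noise_def algebra_simps)
  also have "\<dots> = (1 - p) * (\<Sum>u\<in>A. \<Sum>v\<in>B. h u * h' v) - (\<Sum>u\<in>A. \<Sum>v\<in>B. noise p E u v * (h u * h' v))"
    by (simp add: sum_subtractf sum_distrib_left)
  also have "(\<Sum>u\<in>A. \<Sum>v\<in>B. h u * h' v) = (\<Sum>u\<in>A. h u) * (\<Sum>v\<in>B. h' v)"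
    by (simp add: sum_product)
  finally show ?thesis .
qed

text \<open>Up to the mean-field part, which is nonpositive on the constraint hyperplane, the quadratic
  form of a link is the noise form evaluated at \<open>f\<close> with the sign flipped on the plus side.\<close>

lemma link_gap:
  fixes f :: "nat \<times> int \<Rightarrow> real"
  assumes fin: "finite A" "finite B" and disj: "A \<inter> B = {}"
    and p: "0 < p" "p \<le> 1/3" and n: "n \<ge> 1" and mu: "\<mu> \<ge> 0"
    and con: "real n * (p ^ Suc a + p ^ b) * (\<Sum>v\<in>A. f (v, -1)) + real n * (p ^ a + p ^ Suc b) * (\<Sum>v\<in>B. f (v, 1)) = 0"
    and noise: "\<And>g. (\<Sum>u\<in>A \<union> B. \<Sum>v\<in>A \<union> B. noise p E u v * (g u * g v))
        \<le> \<mu> * (real n * (p ^ max a b + p ^ Suc (min a b))) * (\<Sum>v\<in>A \<union> B. (g v)\<^sup>2)"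
  shows "(\<Sum>u\<in>A. (\<Sum>v\<in>{v \<in> A. v \<noteq> u \<and> {u, v} \<in> E}. f (u, -1) * f (v, -1))
            + (\<Sum>v\<in>{v \<in> B. v \<noteq> u \<and> {u, v} \<notin> E}. f (u, -1) * f (v, 1)))
       + (\<Sum>u\<in>B. (\<Sum>v\<in>{v \<in> A. v \<noteq> u \<and> {u, v} \<notin> E}. f (u, 1) * f (v, -1))
            + (\<Sum>v\<in>{v \<in> B. v \<noteq> u \<and> {u, v} \<in> E}. f (u, 1) * f (v, 1)))
    \<le> \<mu> * (real n * (p ^ Suc a + p ^ b) * (\<Sum>v\<in>A. (f (v, -1))\<^sup>2)
          + real n * (p ^ a + p ^ Suc b) * (\<Sum>v\<in>B. (f (v, 1))\<^sup>2))"
    (is "?Q \<le> ?R")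
proof -
  define g where "g v = (if v \<in> A then f (v, -1) else - f (v, 1))" for v
  define x where "x = (\<Sum>v\<in>A. f (v, -1))"
  define y where "y = (\<Sum>v\<in>B. f (v, 1))"
  define X where "X = (\<Sum>v\<in>A. (f (v, -1))\<^sup>2)"
  define Y where "Y = (\<Sum>v\<in>B. (f (v, 1))\<^sup>2)"
  define S where "S = (\<Sum>u\<in>A \<union> B. \<Sum>v\<in>A \<union> B. noise p E u v * (g u * g v))"
  define NAA where "NAA = (\<Sum>u\<in>A. \<Sum>v\<in>A. noise p E u v * (f (u, -1) * f (v, -1)))"
  define NAB where "NAB = (\<Sum>u\<in>A. \<Sum>v\<in>B. noise p E u v * (f (u, -1) * f (v, 1)))"
  define NBA where "NBA = (\<Sum>u\<in>B. \<Sum>v\<in>A. noise p E u v * (f (u, 1) * f (v, -1)))"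
  define NBB where "NBB = (\<Sum>u\<in>B. \<Sum>v\<in>B. noise p E u v * (f (u, 1) * f (v, 1)))"
  have gA: "g v = f (v, -1)" if "v \<in> A" for v using that by (simp add: g_def)
  have gB: "g v = - f (v, 1)" if "v \<in> B" for v using that disj by (auto simp: g_def)
  have S: "S = NAA - NAB - NBA + NBB"
    unfolding S_def NAA_def NAB_def NBA_def NBB_def
    by (simp add: sum.union_disjoint[OF fin disj] gA gB sum.distrib sum_subtractf sum_negf)
  have sq: "(\<Sum>v\<in>A \<union> B. (g v)\<^sup>2) = X + Y"
    unfolding X_def Y_def by (simp add: sum.union_disjoint[OF fin disj] gA gB)
  have XY: "X \<ge> 0" "Y \<ge> 0" by (auto simp: X_def Y_def sum_nonneg)
  have disj': "B \<inter> A = {}" using disj by auto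
  have "?Q = (p * x\<^sup>2 - p * X + NAA) + ((1 - p) * (x * y) - NAB) + ((1 - p) * (y * x) - NBA) + (p * y\<^sup>2 - p * Y + NBB)"
    unfolding sum.distrib sum_adjacent[OF fin(1), where E=E and h="\<lambda>u. f (u, -1)" and p=p]
      sum_adjacent[OF fin(2), where E=E and h="\<lambda>u. f (u, 1)" and p=p]
      sum_nonadjacent[OF fin disj, where E=E and h="\<lambda>u. f (u, -1)" and h'="\<lambda>v. f (v, 1)" and p=p]
      sum_nonadjacent[OF fin(2,1) disj', where E=E and h="\<lambda>u. f (u, 1)" and h'="\<lambda>v. f (v, -1)" and p=p]
      x_def y_def X_def Y_def NAA_def NAB_def NBA_def NBB_def by simp
  also have "\<dots> = (p * x\<^sup>2 + p * y\<^sup>2 + 2 * (1 - p) * (x * y)) - p * (X + Y) + S"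
    by (simp add: S algebra_simps)
  also have "\<dots> \<le> S"
  proof -
    have "real n * ((p ^ Suc a + p ^ b) * x + (p ^ a + p ^ Suc b) * y) = 0"
      using con by (simp add: x_def y_def algebra_simps)
    then have "(p ^ Suc a + p ^ b) * x + (p ^ a + p ^ Suc b) * y = 0" using n by simp
    then have "p * x\<^sup>2 + p * y\<^sup>2 + 2 * (1 - p) * (x * y) \<le> 0" by (rule mean_part_nonpos[OF p])
    moreover have "p * (X + Y) \<ge> 0" using p XY by simp
    ultimately show ?thesis by simp
  qed
  also have "S \<le> \<mu> * (real n * (p ^ max a b + p ^ Suc (min a b))) * (X + Y)"
    using noise[of g] by (simp add: S_def sq)
  also have "\<dots> = \<mu> * (real n * (p ^ max a b + p ^ Suc (min a b)) * X + real n * (p ^ max a b + p ^ Suc (min a b)) * Y)"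
    by (simp add: algebra_simps)
  also have "\<dots> \<le> \<mu> * (real n * (p ^ Suc a + p ^ b) * X + real n * (p ^ a + p ^ Suc b) * Y)"
  proof -
    have dec: "p ^ i * (1 - p) \<le> p ^ j * (1 - p)" if "j \<le> i" for i j
      using p that by (intro mult_right_mono power_decreasing) auto
    have le: "p ^ max a b + p ^ Suc (min a b) \<le> p ^ Suc a + p ^ b" "p ^ max a b + p ^ Suc (min a b) \<le> p ^ a + p ^ Suc b"
      using dec[of a b] dec[of b a] by (auto simp: max_def min_def algebra_simps)
    show ?thesis
      by (rule mult_left_mono[OF add_mono[OF mult_right_mono[OF mult_left_mono[OF le(1)]]
            mult_right_mono[OF mult_left_mono[OF le(2)]]]]) (use mu XY in auto)
  qed
  finally show ?thesis by (simp add: X_def Y_def)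
qed

theorem Ztilde_vanishing:
  assumes k: "k \<ge> 1" and p: "0 < p" "p \<le> 1/3" and n: "n \<ge> 1" and mu: "\<mu> \<ge> 0"
    and noise: "\<And>\<sigma> \<tau> g. \<sigma> \<subseteq> {1..n} \<Longrightarrow> \<tau> \<subseteq> {1..n} \<Longrightarrow> \<sigma> \<inter> \<tau> = {} \<Longrightarrow> card \<sigma> + card \<tau> = k \<Longrightarrow>
      (\<Sum>u\<in>ext n E \<sigma> \<tau> \<union> ext n E \<tau> \<sigma>. \<Sum>v\<in>ext n E \<sigma> \<tau> \<union> ext n E \<tau> \<sigma>. noise p E u v * (g u * g v))
        \<le> \<mu> * (real n * (p ^ max (card \<sigma>) (card \<tau>) + p ^ Suc (min (card \<sigma>) (card \<tau>))))
            * (\<Sum>v\<in>ext n E \<sigma> \<tau> \<union> ext n E \<tau> \<sigma>. (g v)\<^sup>2)"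
    and deg: "\<And>\<sigma> \<tau>. \<sigma> \<subseteq> {1..n} \<Longrightarrow> \<tau> \<subseteq> {1..n} \<Longrightarrow> \<sigma> \<inter> \<tau> = {} \<Longrightarrow> card \<sigma> + card \<tau> = Suc k \<Longrightarrow>
      \<mu> * real (Suc k) * (real n * (p ^ card \<sigma> + p ^ card \<tau>))
        < real (card (ext n E \<sigma> \<tau>)) + real (card (ext n E \<tau> \<sigma>))"
  shows "rat_homology_vanishes (Ztilde n E) k"
proof -
  interpret finite_complex "Ztilde n E" by (rule finite_complex_Ztilde)
  have face: "\<exists>\<sigma> \<tau>. F = sface \<sigma> \<tau> \<and> sface \<sigma> \<tau> \<in> Ztilde n E \<and> \<sigma> \<subseteq> {1..n} \<and> \<tau> \<subseteq> {1..n} \<and> \<sigma> \<inter> \<tau> = {}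
      \<and> card \<sigma> + card \<tau> = j \<and> finite \<sigma> \<and> finite \<tau>" if F: "F \<in> faces j" for F j
  proof -
    obtain \<sigma> \<tau> where st: "F = sface \<sigma> \<tau>" "sface \<sigma> \<tau> \<in> Ztilde n E" "\<sigma> \<subseteq> {1..n}" "\<tau> \<subseteq> {1..n}" "\<sigma> \<inter> \<tau> = {}"
      by (rule ZtildeE[OF facesD(1)[OF F]])
    then have "finite \<sigma>" "finite \<tau>" by (auto intro: finite_subset)
    then show ?thesis using st facesD(2)[OF F] by (auto simp: card_sface)
  qed
  show ?thesis
  proof (rule garland_vanishing[where m = "sweight n p" and \<mu> = \<mu>])
    fix F assume "F \<in> faces (Suc k)"
    then obtain \<sigma> \<tau> where st: "F = sface \<sigma> \<tau>" "sface \<sigma> \<tau> \<in> Ztilde n E" "\<sigma> \<subseteq> {1..n}" "\<tau> \<subseteq> {1..n}" "\<sigma> \<inter> \<tau> = {}"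
      "card \<sigma> + card \<tau> = Suc k" using face by blast
    show "0 < sweight n p F" using p n by (simp add: st add_pos_pos)
    show "\<mu> * real (Suc k) * sweight n p F < real (card (link F))"
      using deg[OF st(3-6)] by (simp add: st(1) Ztilde_link[OF st(2)] card_sface)
  next
    fix F f assume "F \<in> faces k" and con: "(\<Sum>v\<in>link F. sweight n p (insert v F) * f v) = 0"
    then obtain \<sigma> \<tau> where st: "F = sface \<sigma> \<tau>" "sface \<sigma> \<tau> \<in> Ztilde n E" "\<sigma> \<subseteq> {1..n}" "\<tau> \<subseteq> {1..n}" "\<sigma> \<inter> \<tau> = {}"
      "card \<sigma> + card \<tau> = k" "finite \<sigma>" "finite \<tau>" using face by blast
    let ?A = "ext n E \<sigma> \<tau>" and ?B = "ext n E \<tau> \<sigma>"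
    have "\<sigma> \<union> \<tau> \<noteq> {}" using st(6) k by auto
    then have disj: "?A \<inter> ?B = {}" by (auto simp: ext_def)
    have cA: "card (insert v \<sigma>) = Suc (card \<sigma>)" if "v \<in> ?A" for v
      using that st by (auto simp: ext_def)
    have cB: "card (insert v \<tau>) = Suc (card \<tau>)" if "v \<in> ?B" for v
      using that st by (auto simp: ext_def)
    have sumlink: "(\<Sum>v\<in>link F. sweight n p (insert v F) * h v)
        = real n * (p ^ Suc (card \<sigma>) + p ^ card \<tau>) * (\<Sum>v\<in>?A. h (v, -1))
          + real n * (p ^ card \<sigma> + p ^ Suc (card \<tau>)) * (\<Sum>v\<in>?B. h (v, 1))" for h
      unfolding st(1) Ztilde_link[OF st(2)]
      by (subst sum_sface) (simp_all add: insert_sface cA cB sum_distrib_left)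
    have linkA: "link (insert (u, -1) F) = sface {v \<in> ?A. v \<noteq> u \<and> {u, v} \<in> E} {v \<in> ?B. v \<noteq> u \<and> {u, v} \<notin> E}"
      if "u \<in> ?A" for u
      using Ztilde_link_minus[OF st(2), of u] Ztilde_link[of "insert u \<sigma>" \<tau> n E] that
      by (simp add: st(1) insert_sface ext_insert_left ext_insert_right)
    have linkB: "link (insert (u, 1) F) = sface {v \<in> ?A. v \<noteq> u \<and> {u, v} \<notin> E} {v \<in> ?B. v \<noteq> u \<and> {u, v} \<in> E}"
      if "u \<in> ?B" for u
      using Ztilde_link_plus[OF st(2), of u] Ztilde_link[of \<sigma> "insert u \<tau>" n E] that
      by (simp add: st(1) insert_sface ext_insert_left ext_insert_right)
    have "(\<Sum>u\<in>link F. \<Sum>v\<in>link (insert u F). f u * f v)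
      = (\<Sum>u\<in>?A. \<Sum>v\<in>link (insert (u, -1) F). f (u, -1) * f v)
        + (\<Sum>u\<in>?B. \<Sum>v\<in>link (insert (u, 1) F). f (u, 1) * f v)"
      using Ztilde_link[OF st(2)] by (simp add: st(1) sum_sface)
    also have "\<dots> = (\<Sum>u\<in>?A. (\<Sum>v\<in>{v \<in> ?A. v \<noteq> u \<and> {u, v} \<in> E}. f (u, -1) * f (v, -1))
            + (\<Sum>v\<in>{v \<in> ?B. v \<noteq> u \<and> {u, v} \<notin> E}. f (u, -1) * f (v, 1)))
       + (\<Sum>u\<in>?B. (\<Sum>v\<in>{v \<in> ?A. v \<noteq> u \<and> {u, v} \<notin> E}. f (u, 1) * f (v, -1))
            + (\<Sum>v\<in>{v \<in> ?B. v \<noteq> u \<and> {u, v} \<in> E}. f (u, 1) * f (v, 1)))"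
      by (simp add: linkA linkB sum_sface)
    also have "\<dots> \<le> \<mu> * (real n * (p ^ Suc (card \<sigma>) + p ^ card \<tau>) * (\<Sum>v\<in>?A. (f (v, -1))\<^sup>2)
          + real n * (p ^ card \<sigma> + p ^ Suc (card \<tau>)) * (\<Sum>v\<in>?B. (f (v, 1))\<^sup>2))"
      by (rule link_gap[OF _ _ disj p n mu]) (use con sumlink[of f] noise[OF st(3-6)] in auto)
    finally show "(\<Sum>u\<in>link F. \<Sum>v\<in>link (insert u F). f u * f v)
        \<le> \<mu> * (\<Sum>v\<in>link F. sweight n p (insert v F) * (f v)\<^sup>2)"
      by (simp add: sumlink)
  qed
qed

section \<open>Bernoulli expectations\<close>

definition bexp :: "'e set \<Rightarrow> real \<Rightarrow> ('e set \<Rightarrow> real) \<Rightarrow> real" where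
  "bexp S p F = (\<Sum>X\<in>Pow S. p ^ card X * (1 - p) ^ card (S - X) * F X)"

definition depends_on :: "('e set \<Rightarrow> real) \<Rightarrow> 'e set \<Rightarrow> bool" where
  "depends_on F A \<longleftrightarrow> (\<forall>X. F X = F (X \<inter> A))"

lemma bexp_cong: "(\<And>X. X \<subseteq> S \<Longrightarrow> F X = G X) \<Longrightarrow> bexp S p F = bexp S p G"
  unfolding bexp_def by (intro sum.cong) auto

lemma bexp_mono:
  assumes "0 \<le> p" "p \<le> 1" "\<And>X. X \<subseteq> S \<Longrightarrow> F X \<le> G X"
  shows "bexp S p F \<le> bexp S p G"
  unfolding bexp_def using assms by (intro sum_mono mult_left_mono) auto

lemma bexp_add: "bexp S p (\<lambda>X. F X + G X) = bexp S p F + bexp S p G"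
  by (simp add: bexp_def distrib_left sum.distrib)

lemma bexp_cmult: "bexp S p (\<lambda>X. c * F X) = c * bexp S p F"
  by (simp add: bexp_def sum_distrib_left mult_ac)

lemma bexp_sum: "bexp S p (\<lambda>X. \<Sum>i\<in>I. F i X) = (\<Sum>i\<in>I. bexp S p (F i))"
  unfolding bexp_def sum_distrib_left by (rule sum.swap)

lemma bexp_empty [simp]: "bexp {} p F = F {}"
  by (simp add: bexp_def)

lemma bexp_insert:
  assumes "finite S" "e \<notin> S"
  shows "bexp (insert e S) p F = (1 - p) * bexp S p F + p * bexp S p (\<lambda>X. F (insert e X))"
proof -
  have disj: "Pow S \<inter> insert e ` Pow S = {}" using assms by auto
  have inj: "inj_on (insert e) (Pow S)" using assms by (auto simp: inj_on_def)
  have "bexp (insert e S) p F = (\<Sum>X\<in>Pow S. p ^ card X * (1 - p) ^ card (insert e S - X) * F X)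
      + (\<Sum>X\<in>Pow S. p ^ card (insert e X) * (1 - p) ^ card (insert e S - insert e X) * F (insert e X))"
    unfolding bexp_def Pow_insert using assms disj inj
    by (subst sum.union_disjoint) (auto simp: sum.reindex)
  also have "(\<Sum>X\<in>Pow S. p ^ card X * (1 - p) ^ card (insert e S - X) * F X) = (1 - p) * bexp S p F"
    unfolding bexp_def sum_distrib_left
  proof (rule sum.cong[OF refl])
    fix X assume "X \<in> Pow S"
    then have "insert e S - X = insert e (S - X)" using assms by auto
    then have "card (insert e S - X) = Suc (card (S - X))" using assms by simp
    then show "p ^ card X * (1 - p) ^ card (insert e S - X) * F X
        = (1 - p) * (p ^ card X * (1 - p) ^ card (S - X) * F X)" by simp
  qed
  also have "(\<Sum>X\<in>Pow S. p ^ card (insert e X) * (1 - p) ^ card (insert e S - insert e X) * F (insert e X))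
      = p * bexp S p (\<lambda>X. F (insert e X))"
    unfolding bexp_def sum_distrib_left
  proof (rule sum.cong[OF refl])
    fix X assume X: "X \<in> Pow S"
    then have "insert e S - insert e X = S - X" using assms by auto
    moreover have "card (insert e X) = Suc (card X)"
      using X assms by (subst card_insert_disjoint) (auto intro: finite_subset)
    ultimately show "p ^ card (insert e X) * (1 - p) ^ card (insert e S - insert e X) * F (insert e X)
        = p * (p ^ card X * (1 - p) ^ card (S - X) * F (insert e X))" by simp
  qed
  finally show ?thesis .
qed

lemma bexp_Un:
  assumes "finite S" "finite T" "S \<inter> T = {}"
  shows "bexp (S \<union> T) p F = bexp S p (\<lambda>X. bexp T p (\<lambda>Y. F (X \<union> Y)))"
  using assms(1,3)
proof (induction S arbitrary: F rule: finite_induct)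
  case (insert e S)
  then have "bexp (insert e S \<union> T) p F
      = (1 - p) * bexp (S \<union> T) p F + p * bexp (S \<union> T) p (\<lambda>X. F (insert e X))"
    using assms(2) by (simp add: bexp_insert)
  also have "\<dots> = bexp (insert e S) p (\<lambda>X. bexp T p (\<lambda>Y. F (X \<union> Y)))"
    using insert by (simp add: bexp_insert)
  finally show ?case .
qed simp

lemma bexp_const: "finite S \<Longrightarrow> bexp S p (\<lambda>_. c) = c"
  by (induction S rule: finite_induct) (simp_all add: bexp_insert algebra_simps)

lemma bexp_restrict:
  assumes "finite S" "A \<subseteq> S" "depends_on F A"
  shows "bexp S p F = bexp A p F"
proof -
  have fin: "finite A" "finite (S - A)" using assms by (auto intro: finite_subset)
  have "bexp S p F = bexp (A \<union> (S - A)) p F" using assms(2) by (simp add: Un_absorb1)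
  also have "\<dots> = bexp A p (\<lambda>X. bexp (S - A) p (\<lambda>Y. F (X \<union> Y)))"
    by (rule bexp_Un[OF fin]) auto
  also have "\<dots> = bexp A p (\<lambda>X. bexp (S - A) p (\<lambda>Y. F X))"
  proof (intro bexp_cong)
    fix X Y assume "X \<subseteq> A" "Y \<subseteq> S - A"
    then have "(X \<union> Y) \<inter> A = X \<inter> A" by auto
    then show "F (X \<union> Y) = F X" using assms(3) unfolding depends_on_def by metis
  qed
  also have "\<dots> = bexp A p F" using fin by (simp add: bexp_const)
  finally show ?thesis .
qed

lemma depends_on_mono: "depends_on F A \<Longrightarrow> A \<subseteq> B \<Longrightarrow> depends_on F B"
  unfolding depends_on_def by (metis inf.absorb2 inf_assoc)

lemma depends_on_prod:
  "(\<And>i. i \<in> I \<Longrightarrow> depends_on (F i) A) \<Longrightarrow> depends_on (\<lambda>X. \<Prod>i\<in>I. F i X) A"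
  unfolding depends_on_def by (intro allI prod.cong refl) metis

lemma bexp_mult:
  assumes "finite S" "A \<subseteq> S" "B \<subseteq> S" "A \<inter> B = {}" "depends_on F A" "depends_on G B"
  shows "bexp S p (\<lambda>X. F X * G X) = bexp S p F * bexp S p G"
proof -
  have fin: "finite A" "finite B" using assms by (auto intro: finite_subset)
  have "depends_on (\<lambda>X. F X * G X) (A \<union> B)"
    using depends_on_mono[OF assms(5), of "A \<union> B"] depends_on_mono[OF assms(6), of "A \<union> B"]
    unfolding depends_on_def by (metis Un_upper1 Un_upper2)
  then have "bexp S p (\<lambda>X. F X * G X) = bexp (A \<union> B) p (\<lambda>X. F X * G X)"
    using assms by (intro bexp_restrict) auto
  also have "\<dots> = bexp A p (\<lambda>X. bexp B p (\<lambda>Y. F (X \<union> Y) * G (X \<union> Y)))"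
    by (rule bexp_Un[OF fin assms(4)])
  also have "\<dots> = bexp A p (\<lambda>X. bexp B p (\<lambda>Y. F X * G Y))"
  proof (intro bexp_cong)
    fix X Y assume "X \<subseteq> A" "Y \<subseteq> B"
    then have "(X \<union> Y) \<inter> A = X \<inter> A" "(X \<union> Y) \<inter> B = Y \<inter> B" using assms(4) by auto
    then have "F (X \<union> Y) = F X" "G (X \<union> Y) = G Y"
      using assms(5,6) unfolding depends_on_def by metis+
    then show "F (X \<union> Y) * G (X \<union> Y) = F X * G Y" by simp
  qed
  also have "\<dots> = bexp A p (\<lambda>X. bexp B p G * F X)" by (simp add: bexp_cmult mult.commute)
  also have "\<dots> = bexp A p F * bexp B p G" by (simp add: bexp_cmult)
  also have "\<dots> = bexp S p F * bexp S p G"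
    using assms by (simp add: bexp_restrict)
  finally show ?thesis .
qed

lemma bexp_prod:
  assumes "finite S" "finite I" "\<And>i. i \<in> I \<Longrightarrow> A i \<subseteq> S" "\<And>i. i \<in> I \<Longrightarrow> depends_on (F i) (A i)"
    and "\<And>i j. i \<in> I \<Longrightarrow> j \<in> I \<Longrightarrow> i \<noteq> j \<Longrightarrow> A i \<inter> A j = {}"
  shows "bexp S p (\<lambda>X. \<Prod>i\<in>I. F i X) = (\<Prod>i\<in>I. bexp S p (F i))"
  using assms(2-5)
proof (induction I rule: finite_induct)
  case empty
  then show ?case using assms(1) by (simp add: bexp_const)
next
  case (insert i I)
  have "bexp S p (\<lambda>X. F i X * (\<Prod>j\<in>I. F j X)) = bexp S p (F i) * bexp S p (\<lambda>X. \<Prod>j\<in>I. F j X)"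
  proof (rule bexp_mult[OF assms(1), of "A i" "\<Union>j\<in>I. A j"])
    show "A i \<inter> (\<Union>j\<in>I. A j) = {}" using insert.prems(3)[of i] insert.hyps by blast
    show "depends_on (\<lambda>X. \<Prod>j\<in>I. F j X) (\<Union>j\<in>I. A j)"
      using insert.prems(2) by (intro depends_on_prod depends_on_mono[OF insert.prems(2)]) auto
  qed (use insert.prems in auto)
  moreover have "bexp S p (\<lambda>X. \<Prod>j\<in>I. F j X) = (\<Prod>j\<in>I. bexp S p (F j))"
    using insert.prems by (intro insert.IH) auto
  ultimately show ?case using insert.hyps by simp
qed

lemma bexp_single:
  assumes "finite S" "e \<in> S"
  shows "bexp S p (\<lambda>X. h (e \<in> X)) = p * h True + (1 - p) * h False"
proof -
  have "bexp S p (\<lambda>X. h (e \<in> X)) = bexp {e} p (\<lambda>X. h (e \<in> X))"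
    using assms by (intro bexp_restrict) (auto simp: depends_on_def)
  then show ?thesis by (simp add: bexp_insert)
qed

lemma finite_all_edges [simp]: "finite (all_edges n)"
  by (rule finite_subset[of _ "Pow {1..n}"]) (auto simp: all_edges_def)

lemma prob_Gnp_bexp: "prob_Gnp n p P = bexp (all_edges n) p (\<lambda>E. of_bool (P E))"
  unfolding prob_Gnp_def bexp_def
  by (intro sum.cong) (auto simp: card_Diff_subset finite_subset)

lemma prob_compl: "1 - prob_Gnp n p P = bexp (all_edges n) p (\<lambda>E. of_bool (\<not> P E))"
proof -
  have "bexp (all_edges n) p (\<lambda>E. of_bool (P E)) + bexp (all_edges n) p (\<lambda>E. of_bool (\<not> P E))
      = bexp (all_edges n) p (\<lambda>_. 1)"
    unfolding bexp_add[symmetric] by (rule bexp_cong) auto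
  then show ?thesis by (simp add: prob_Gnp_bexp bexp_const)
qed

definition star :: "nat set \<Rightarrow> nat \<Rightarrow> nat set set" where
  "star S v = (\<lambda>s. {v, s}) ` S"

lemma star_subset: "S \<subseteq> {1..n} \<Longrightarrow> v \<in> {1..n} - S \<Longrightarrow> star S v \<subseteq> all_edges n"
  by (auto simp: star_def all_edges_def card_2_iff)

lemma star_disjoint: "v \<notin> S \<Longrightarrow> w \<notin> S \<Longrightarrow> v \<noteq> w \<Longrightarrow> star S v \<inter> star S w = {}"
  by (auto simp: star_def doubleton_eq_iff)

lemma depends_on_ext:
  "depends_on (\<lambda>X. h (v \<in> ext n X \<sigma> \<tau>)) (star (\<sigma> \<union> \<tau>) v)"
  by (auto simp: depends_on_def ext_def star_def intro!: arg_cong[of _ _ h])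

lemma bexp_ext:
  assumes "\<sigma> \<subseteq> {1..n}" "\<tau> \<subseteq> {1..n}" "\<sigma> \<inter> \<tau> = {}" "v \<in> {1..n} - \<sigma> - \<tau>"
  shows "bexp (all_edges n) p (\<lambda>X. of_bool (v \<in> ext n X \<sigma> \<tau>)) = p ^ card \<sigma> * (1 - p) ^ card \<tau>"
proof -
  have fin: "finite \<sigma>" "finite \<tau>" using assms by (auto intro: finite_subset)
  have edge: "{v, s} \<in> all_edges n" if "s \<in> \<sigma> \<union> \<tau>" for s
    using star_subset[of "\<sigma> \<union> \<tau>" n v] assms that by (auto simp: star_def)
  have "bexp (all_edges n) p (\<lambda>X. of_bool (v \<in> ext n X \<sigma> \<tau>))
      = bexp (all_edges n) p (\<lambda>X. \<Prod>s\<in>\<sigma> \<union> \<tau>. of_bool (({v, s} \<in> X) = (s \<in> \<sigma>)))"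
  proof (rule bexp_cong)
    fix X :: "nat set set"
    have "v \<in> ext n X \<sigma> \<tau> \<longleftrightarrow> (\<forall>s\<in>\<sigma> \<union> \<tau>. ({v, s} \<in> X) = (s \<in> \<sigma>))"
      using assms by (auto simp: ext_def)
    moreover have "(\<Prod>s\<in>S. of_bool (Q s)) = (of_bool (\<forall>s\<in>S. Q s) :: real)" if "finite S" for Q and S :: "nat set"
      using that by induction auto
    ultimately show "of_bool (v \<in> ext n X \<sigma> \<tau>) = (\<Prod>s\<in>\<sigma> \<union> \<tau>. of_bool (({v, s} \<in> X) = (s \<in> \<sigma>)) :: real)"
      using fin by simp
  qed
  also have "\<dots> = (\<Prod>s\<in>\<sigma> \<union> \<tau>. bexp (all_edges n) p (\<lambda>X. of_bool (({v, s} \<in> X) = (s \<in> \<sigma>))))"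
    using assms edge fin by (intro bexp_prod[where A = "\<lambda>s. {{v, s}}"])
      (auto simp: depends_on_def doubleton_eq_iff)
  also have "\<dots> = (\<Prod>s\<in>\<sigma> \<union> \<tau>. if s \<in> \<sigma> then p else 1 - p)"
  proof (rule prod.cong[OF refl])
    fix s assume "s \<in> \<sigma> \<union> \<tau>"
    then show "bexp (all_edges n) p (\<lambda>X. of_bool (({v, s} \<in> X) = (s \<in> \<sigma>))) = (if s \<in> \<sigma> then p else 1 - p)"
      using bexp_single[OF finite_all_edges edge, of s p "\<lambda>b. of_bool (b = (s \<in> \<sigma>))"] by simp
  qed
  also have "\<dots> = (\<Prod>s\<in>\<sigma>. if s \<in> \<sigma> then p else 1 - p) * (\<Prod>s\<in>\<tau>. if s \<in> \<sigma> then p else 1 - p)"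
    using fin assms by (intro prod.union_disjoint) auto
  also have "(\<Prod>s\<in>\<tau>. if s \<in> \<sigma> then p else 1 - p) = (\<Prod>s\<in>\<tau>. 1 - p)"
    using assms by (intro prod.cong) auto
  finally show ?thesis by simp
qed

text \<open>Markov's inequality for \<open>2 ^ (- card (ext n X \<sigma> \<tau>))\<close>, which is a product of independent factors.\<close>

lemma ext_lower_tail:
  assumes st: "\<sigma> \<subseteq> {1..n}" "\<tau> \<subseteq> {1..n}" "\<sigma> \<inter> \<tau> = {}" and p: "0 \<le> p" "p \<le> 1"
  shows "bexp (all_edges n) p (\<lambda>X. of_bool (real (card (ext n X \<sigma> \<tau>)) \<le> s))
    \<le> exp (s - p ^ card \<sigma> * (1 - p) ^ card \<tau> * (real n - real (card \<sigma> + card \<tau>)) / 2)"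
proof (cases "s \<ge> 0")
  case False
  then have "bexp (all_edges n) p (\<lambda>X. of_bool (real (card (ext n X \<sigma> \<tau>)) \<le> s)) = bexp (all_edges n) p (\<lambda>X. 0)"
    by (intro bexp_cong) (auto simp: not_le)
  then show ?thesis by (simp add: bexp_const)
next
  case True
  define V where "V = {1..n} - \<sigma> - \<tau>"
  define q where "q = p ^ card \<sigma> * (1 - p) ^ card \<tau>"
  have fin: "finite \<sigma>" "finite \<tau>" "finite V" using st by (auto simp: V_def intro: finite_subset)
  have q: "0 \<le> q" "q \<le> 1" using p by (auto simp: q_def power_le_one mult_le_one)
  have "card V = n - (card \<sigma> + card \<tau>)"
  proof -
    have "V = {1..n} - (\<sigma> \<union> \<tau>)" by (auto simp: V_def)
    then show ?thesis using fin st by (simp add: card_Diff_subset card_Un_disjoint)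
  qed
  then have cV: "real (card V) \<ge> real n - real (card \<sigma> + card \<tau>)" by linarith
  have ind: "(\<Prod>v\<in>V. 1 - of_bool (v \<in> ext n X \<sigma> \<tau>) / 2) = (1/2::real) ^ card (ext n X \<sigma> \<tau>)" for X
  proof -
    have sub: "ext n X \<sigma> \<tau> \<subseteq> V" by (auto simp: ext_def V_def)
    have "(\<Prod>v\<in>V. 1 - of_bool (v \<in> ext n X \<sigma> \<tau>) / 2) = (\<Prod>v\<in>ext n X \<sigma> \<tau>. 1 - of_bool (v \<in> ext n X \<sigma> \<tau>) / 2 :: real)"
      using fin sub by (intro prod.mono_neutral_right) auto
    then show ?thesis by simp
  qed
  have "of_bool (real (card (ext n X \<sigma> \<tau>)) \<le> s) \<le> exp s * (\<Prod>v\<in>V. 1 - of_bool (v \<in> ext n X \<sigma> \<tau>) / 2)" for X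
  proof (cases "real (card (ext n X \<sigma> \<tau>)) \<le> s")
    case True
    have "(2::real) ^ card (ext n X \<sigma> \<tau>) \<le> exp 1 ^ card (ext n X \<sigma> \<tau>)"
      using exp_ge_add_one_self[of 1] by (intro power_mono) auto
    also have "\<dots> = exp (real (card (ext n X \<sigma> \<tau>)))" by (simp add: exp_of_nat_mult[symmetric])
    also have "\<dots> \<le> exp s" using True by simp
    finally show ?thesis using True unfolding ind by (simp add: power_one_over field_simps)
  next
    case False
    then show ?thesis unfolding ind by simp
  qed
  then have "bexp (all_edges n) p (\<lambda>X. of_bool (real (card (ext n X \<sigma> \<tau>)) \<le> s))
      \<le> bexp (all_edges n) p (\<lambda>X. exp s * (\<Prod>v\<in>V. 1 - of_bool (v \<in> ext n X \<sigma> \<tau>) / 2))"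
    using p by (intro bexp_mono) auto
  also have "\<dots> = exp s * (\<Prod>v\<in>V. bexp (all_edges n) p (\<lambda>X. 1 - of_bool (v \<in> ext n X \<sigma> \<tau>) / 2))"
  proof -
    have "bexp (all_edges n) p (\<lambda>X. \<Prod>v\<in>V. 1 - of_bool (v \<in> ext n X \<sigma> \<tau>) / 2)
        = (\<Prod>v\<in>V. bexp (all_edges n) p (\<lambda>X. 1 - of_bool (v \<in> ext n X \<sigma> \<tau>) / 2))"
    proof (rule bexp_prod[where A = "star (\<sigma> \<union> \<tau>)"])
      show "star (\<sigma> \<union> \<tau>) v \<subseteq> all_edges n" if "v \<in> V" for v
        using that st by (intro star_subset) (auto simp: V_def)
      show "star (\<sigma> \<union> \<tau>) v \<inter> star (\<sigma> \<union> \<tau>) w = {}" if "v \<in> V" "w \<in> V" "v \<noteq> w" for v w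
        using that by (intro star_disjoint) (auto simp: V_def)
    qed (use fin in \<open>auto intro: depends_on_ext[where h="\<lambda>b. 1 - of_bool b / 2"]\<close>)
    then show ?thesis by (simp only: bexp_cmult)
  qed
  also have "(\<Prod>v\<in>V. bexp (all_edges n) p (\<lambda>X. 1 - of_bool (v \<in> ext n X \<sigma> \<tau>) / 2)) = (\<Prod>v\<in>V. 1 - q / 2)"
  proof (rule prod.cong[OF refl])
    fix v assume "v \<in> V"
    then have "bexp (all_edges n) p (\<lambda>X. of_bool (v \<in> ext n X \<sigma> \<tau>)) = q"
      using st by (simp add: V_def q_def bexp_ext)
    then show "bexp (all_edges n) p (\<lambda>X. 1 - of_bool (v \<in> ext n X \<sigma> \<tau>) / 2) = 1 - q / 2"
      using bexp_add[of "all_edges n" p "\<lambda>_. 1" "\<lambda>X. (-1/2) * of_bool (v \<in> ext n X \<sigma> \<tau>)"]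
        bexp_cmult[of "all_edges n" p "-1/2" "\<lambda>X. of_bool (v \<in> ext n X \<sigma> \<tau>)"]
      by (simp add: bexp_const)
  qed
  also have "exp s * (\<Prod>v\<in>V. 1 - q / 2) \<le> exp s * exp (- q / 2) ^ card V"
    using q exp_ge_add_one_self[of "- q / 2"] by (simp add: power_mono)
  also have "\<dots> = exp (s - q * real (card V) / 2)"
    by (simp add: exp_of_nat_mult[symmetric] exp_add[symmetric] mult_ac)
  also have "\<dots> \<le> exp (s - q * (real n - real (card \<sigma> + card \<tau>)) / 2)"
    using mult_left_mono[OF cV q(1)] by simp
  finally show ?thesis by (simp add: q_def)
qed

section \<open>Traces of matrix powers\<close>

fun mpow :: "'a set \<Rightarrow> ('a \<Rightarrow> 'a \<Rightarrow> real) \<Rightarrow> nat \<Rightarrow> 'a \<Rightarrow> 'a \<Rightarrow> real" where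
  "mpow V N 0 u v = of_bool (u = v)"
| "mpow V N (Suc m) u v = (\<Sum>w\<in>V. mpow V N m u w * N w v)"

lemma mpow_add:
  assumes "finite V" "v \<in> V"
  shows "mpow V N (m + l) u v = (\<Sum>w\<in>V. mpow V N m u w * mpow V N l w v)"
  using assms(2)
proof (induction l arbitrary: v)
  case 0
  have "(\<Sum>w\<in>V. mpow V N m u w * mpow V N 0 w v) = (\<Sum>w\<in>V. if w = v then mpow V N m u w else 0)"
    by (intro sum.cong) auto
  then show ?case using assms(1) 0 by simp
next
  case (Suc l)
  have "mpow V N (m + Suc l) u v = (\<Sum>w\<in>V. (\<Sum>x\<in>V. mpow V N m u x * mpow V N l x w) * N w v)"
    using Suc.IH by simp
  also have "\<dots> = (\<Sum>w\<in>V. \<Sum>x\<in>V. mpow V N m u x * (mpow V N l x w * N w v))"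
    by (simp add: sum_distrib_right mult.assoc)
  also have "\<dots> = (\<Sum>x\<in>V. \<Sum>w\<in>V. mpow V N m u x * (mpow V N l x w * N w v))"
    by (rule sum.swap)
  finally show ?case by (simp add: sum_distrib_left)
qed

lemma mpow_1: "finite V \<Longrightarrow> u \<in> V \<Longrightarrow> mpow V N 1 u v = N u v"
proof -
  assume "finite V" "u \<in> V"
  have "mpow V N 1 u v = (\<Sum>w\<in>V. if w = u then N w v else 0)"
    unfolding One_nat_def mpow.simps by (intro sum.cong) auto
  then show ?thesis using \<open>finite V\<close> \<open>u \<in> V\<close> by simp
qed

lemma mpow_sym:
  assumes "finite V" "\<forall>u v. N u v = N v u" "u \<in> V" "v \<in> V"
  shows "mpow V N m u v = mpow V N m v u"
  using assms(3,4)
proof (induction m arbitrary: u v)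
  case (Suc m)
  have "mpow V N m u w * N w v = N v w * mpow V N m w u" if "w \<in> V" for w
    using Suc.IH[OF Suc.prems(1) that] assms(2) by (metis mult.commute)
  then have "mpow V N (Suc m) u v = (\<Sum>w\<in>V. N v w * mpow V N m w u)"
    by simp
  also have "\<dots> = (\<Sum>w\<in>V. mpow V N 1 v w * mpow V N m w u)"
    by (rule sum.cong[OF refl], subst mpow_1) (use Suc assms(1) in auto)
  also have "\<dots> = mpow V N (1 + m) v u"
    using Suc assms(1) by (intro mpow_add[symmetric]) auto
  finally show ?case by simp
qed auto

definition qform :: "'a set \<Rightarrow> ('a \<Rightarrow> 'a \<Rightarrow> real) \<Rightarrow> ('a \<Rightarrow> real) \<Rightarrow> real" where
  "qform V N g = (\<Sum>u\<in>V. \<Sum>v\<in>V. N u v * (g u * g v))"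

lemma qform_double:
  assumes "finite V" "\<forall>u v. N u v = N v u"
  shows "qform V (mpow V N (m + m)) g = (\<Sum>u\<in>V. (\<Sum>v\<in>V. mpow V N m u v * g v)\<^sup>2)"
proof -
  have "(\<Sum>u\<in>V. (\<Sum>v\<in>V. mpow V N m u v * g v)\<^sup>2)
      = (\<Sum>u\<in>V. \<Sum>v\<in>V. \<Sum>w\<in>V. (mpow V N m u v * g v) * (mpow V N m u w * g w))"
    by (simp add: power2_eq_square sum_product)
  also have "\<dots> = (\<Sum>v\<in>V. \<Sum>u\<in>V. \<Sum>w\<in>V. (mpow V N m u v * g v) * (mpow V N m u w * g w))"
    by (rule sum.swap)
  also have "\<dots> = (\<Sum>v\<in>V. \<Sum>w\<in>V. \<Sum>u\<in>V. (mpow V N m u v * g v) * (mpow V N m u w * g w))"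
    by (rule sum.cong[OF refl], rule sum.swap)
  also have "\<dots> = (\<Sum>v\<in>V. \<Sum>w\<in>V. mpow V N (m + m) v w * (g v * g w))"
  proof (rule sum.cong[OF refl], rule sum.cong[OF refl])
    fix v w assume vw: "v \<in> V" "w \<in> V"
    have "mpow V N (m + m) v w * (g v * g w) = (\<Sum>u\<in>V. (mpow V N m v u * mpow V N m u w) * (g v * g w))"
      using vw assms(1) by (simp add: mpow_add sum_distrib_right)
    also have "\<dots> = (\<Sum>u\<in>V. (mpow V N m u v * g v) * (mpow V N m u w * g w))"
    proof (rule sum.cong[OF refl])
      fix u assume "u \<in> V"
      then show "(mpow V N m v u * mpow V N m u w) * (g v * g w) = (mpow V N m u v * g v) * (mpow V N m u w * g w)"
        using mpow_sym[OF assms, of v u m] vw by simp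
    qed
    finally show "(\<Sum>u\<in>V. (mpow V N m u v * g v) * (mpow V N m u w * g w)) = mpow V N (m + m) v w * (g v * g w)"
      by simp
  qed
  finally show ?thesis by (simp add: qform_def)
qed

lemma qform_square_le:
  assumes "finite V" "\<forall>u v. N u v = N v u"
  shows "(qform V (mpow V N m) g)\<^sup>2 \<le> (\<Sum>v\<in>V. (g v)\<^sup>2) * qform V (mpow V N (m + m)) g"
proof -
  have "qform V (mpow V N m) g = (\<Sum>u\<in>V. g u * (\<Sum>v\<in>V. mpow V N m u v * g v))"
    by (simp add: qform_def sum_distrib_left mult_ac)
  then show ?thesis
    unfolding qform_double[OF assms] using Cauchy_Schwarz_ineq_sum by metis
qed

lemma qform_power_le:
  assumes "finite V" "\<forall>u v. N u v = N v u"
  shows "\<bar>qform V N g\<bar> ^ (2 ^ j) \<le> (\<Sum>v\<in>V. (g v)\<^sup>2) ^ (2 ^ j - 1) * \<bar>qform V (mpow V N (2 ^ j)) g\<bar>"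
proof (induction j)
  case 0
  have "qform V (mpow V N 1) g = qform V N g"
    unfolding qform_def using assms(1)
    by (intro sum.cong refl, subst mpow_1) auto
  then show ?case by (simp del: mpow.simps)
next
  case (Suc j)
  define G where "G = (\<Sum>v\<in>V. (g v)\<^sup>2)"
  have G: "G \<ge> 0" by (simp add: G_def sum_nonneg)
  have "\<bar>qform V N g\<bar> ^ (2 ^ Suc j) = (\<bar>qform V N g\<bar> ^ (2 ^ j))\<^sup>2"
    by (simp add: power_mult[symmetric] mult.commute)
  also have "\<dots> \<le> (G ^ (2 ^ j - 1) * \<bar>qform V (mpow V N (2 ^ j)) g\<bar>)\<^sup>2"
    using Suc by (intro power_mono) (auto simp: G_def)
  also have "\<dots> = (G ^ (2 ^ j - 1))\<^sup>2 * (qform V (mpow V N (2 ^ j)) g)\<^sup>2"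
    by (simp add: power_mult_distrib)
  also have "\<dots> \<le> (G ^ (2 ^ j - 1))\<^sup>2 * (G * qform V (mpow V N (2 ^ j + 2 ^ j)) g)"
    using qform_square_le[OF assms] by (intro mult_left_mono) (auto simp: G_def)
  also have "\<dots> \<le> (G ^ (2 ^ j - 1))\<^sup>2 * (G * \<bar>qform V (mpow V N (2 ^ Suc j)) g\<bar>)"
    using G by (intro mult_left_mono) (auto simp: mult_2)
  also have "\<dots> = G ^ (2 * (2 ^ j - 1) + 1) * \<bar>qform V (mpow V N (2 ^ Suc j)) g\<bar>"
    unfolding power_add power_even_eq by (simp add: mult_ac)
  also have "2 * (2 ^ j - 1) + 1 = (2 ^ Suc j - 1 :: nat)"
  proof -
    have "(1::nat) \<le> 2 ^ j" by simp
    then show ?thesis unfolding power_Suc by linarith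
  qed
  finally show ?case by (simp add: G_def)
qed

lemma qform_power_le_trace:
  assumes "finite V" "\<forall>u v. N u v = N v u" and L: "L = 2 ^ Suc j"
  shows "\<bar>qform V N g\<bar> ^ L \<le> (\<Sum>v\<in>V. (g v)\<^sup>2) ^ L * (\<Sum>u\<in>V. mpow V N L u u)"
proof -
  define G where "G = (\<Sum>v\<in>V. (g v)\<^sup>2)"
  have G: "G \<ge> 0" by (simp add: G_def sum_nonneg)
  define m :: nat where "m = 2 ^ j"
  have Lm: "L = m + m" using L by (simp add: m_def)
  have tr: "(\<Sum>u\<in>V. mpow V N L u u) = (\<Sum>u\<in>V. \<Sum>v\<in>V. (mpow V N m u v)\<^sup>2)"
  proof (rule sum.cong[OF refl])
    fix u assume u: "u \<in> V"
    have "mpow V N L u u = (\<Sum>v\<in>V. mpow V N m u v * mpow V N m v u)"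
      unfolding Lm by (rule mpow_add[OF assms(1) u])
    also have "\<dots> = (\<Sum>v\<in>V. (mpow V N m u v)\<^sup>2)"
      using mpow_sym[OF assms(1,2) u, of _ m] by (intro sum.cong) (auto simp: power2_eq_square)
    finally show "mpow V N L u u = (\<Sum>v\<in>V. (mpow V N m u v)\<^sup>2)" .
  qed
  have "qform V (mpow V N L) g \<le> (\<Sum>u\<in>V. (\<Sum>v\<in>V. (mpow V N m u v)\<^sup>2) * G)"
    unfolding Lm qform_double[OF assms(1,2)] G_def by (intro sum_mono Cauchy_Schwarz_ineq_sum)
  also have "\<dots> = G * (\<Sum>u\<in>V. mpow V N L u u)"
    unfolding tr sum_distrib_right[symmetric] by (rule mult.commute)
  finally have le: "qform V (mpow V N L) g \<le> G * (\<Sum>u\<in>V. mpow V N L u u)" .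
  have nn: "qform V (mpow V N L) g \<ge> 0"
    unfolding Lm qform_double[OF assms(1,2)] by (simp add: sum_nonneg)
  have "\<bar>qform V N g\<bar> ^ L \<le> G ^ (L - 1) * \<bar>qform V (mpow V N L) g\<bar>"
    unfolding L G_def by (rule qform_power_le[OF assms(1,2)])
  also have "\<dots> \<le> G ^ (L - 1) * (G * (\<Sum>u\<in>V. mpow V N L u u))"
    using le nn G by (intro mult_left_mono) auto
  also have "\<dots> = G ^ L * (\<Sum>u\<in>V. mpow V N L u u)"
  proof -
    have "L = Suc (L - 1)" using L by simp
    then have "G ^ L = G ^ (L - 1) * G" by (metis power_Suc2)
    then show ?thesis by simp
  qed
  finally show ?thesis by (simp add: G_def)
qed

lemma mpow_walks:
  assumes "finite V" "u \<in> V" "v \<in> V"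
  shows "mpow V N m u v = (\<Sum>x\<in>{..m} \<rightarrow>\<^sub>E V. of_bool (x 0 = u \<and> x m = v) * (\<Prod>i<m. N (x i) (x (Suc i))))"
  using assms(3)
proof (induction m arbitrary: v)
  case 0
  have 1: "{..0::nat} \<rightarrow>\<^sub>E V = (\<lambda>y. (\<lambda>i. undefined)(0 := y)) ` V"
    using PiE_insert_eq[of 0 "{}" "\<lambda>_. V"] by (auto simp: image_iff)
  have "inj_on (\<lambda>y. (\<lambda>i::nat. undefined)(0 := y)) V"
    by (rule inj_onI) (metis fun_upd_same)
  then have "(\<Sum>x\<in>{..0} \<rightarrow>\<^sub>E V. of_bool (x 0 = u \<and> x 0 = v) * (\<Prod>i<0. N (x i) (x (Suc i))))
      = (\<Sum>y\<in>V. of_bool (y = u \<and> y = v))"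
    unfolding 1 by (subst sum.reindex) auto
  also have "\<dots> = (\<Sum>y\<in>V. if y = u then of_bool (u = v) else 0)"
    by (intro sum.cong) auto
  finally show ?case using assms by simp
next
  case (Suc m)
  let ?h = "\<lambda>x. \<Prod>i<m. N (x i) (x (Suc i))"
  have fin: "finite ({..m} \<rightarrow>\<^sub>E V)" using assms(1) by (intro finite_PiE) auto
  have "mpow V N (Suc m) u v
      = (\<Sum>w\<in>V. (\<Sum>x\<in>{..m} \<rightarrow>\<^sub>E V. of_bool (x 0 = u \<and> x m = w) * ?h x) * N w v)"
    using Suc.IH by simp
  also have "\<dots> = (\<Sum>w\<in>V. \<Sum>x\<in>{..m} \<rightarrow>\<^sub>E V. if w = x m then of_bool (x 0 = u) * ?h x * N (x m) v else 0)"
    unfolding sum_distrib_right by (intro sum.cong refl) auto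
  also have "\<dots> = (\<Sum>x\<in>{..m} \<rightarrow>\<^sub>E V. \<Sum>w\<in>V. if w = x m then of_bool (x 0 = u) * ?h x * N (x m) v else 0)"
    by (rule sum.swap)
  also have "\<dots> = (\<Sum>x\<in>{..m} \<rightarrow>\<^sub>E V. of_bool (x 0 = u) * ?h x * N (x m) v)"
  proof (rule sum.cong[OF refl])
    fix x assume "x \<in> {..m} \<rightarrow>\<^sub>E V"
    then have "x m \<in> V" by auto
    then show "(\<Sum>w\<in>V. if w = x m then of_bool (x 0 = u) * ?h x * N (x m) v else 0) = of_bool (x 0 = u) * ?h x * N (x m) v"
      using assms(1) by simp
  qed
  also have "\<dots> = (\<Sum>x\<in>{..m} \<rightarrow>\<^sub>E V. \<Sum>y\<in>V. if y = v then of_bool (x 0 = u) * ?h x * N (x m) y else 0)"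
    using assms(1) Suc.prems by simp
  also have "\<dots> = (\<Sum>y\<in>V. \<Sum>x\<in>{..m} \<rightarrow>\<^sub>E V. if y = v then of_bool (x 0 = u) * ?h x * N (x m) y else 0)"
    by (rule sum.swap)
  also have "\<dots> = (\<Sum>(y, x)\<in>V \<times> ({..m} \<rightarrow>\<^sub>E V). if y = v then of_bool (x 0 = u) * ?h x * N (x m) y else 0)"
    by (rule sum.cartesian_product)
  also have "\<dots> = (\<Sum>x\<in>{..Suc m} \<rightarrow>\<^sub>E V. of_bool (x 0 = u \<and> x (Suc m) = v) * (\<Prod>i<Suc m. N (x i) (x (Suc i))))"
  proof -
    have 1: "{..Suc m} \<rightarrow>\<^sub>E V = (\<lambda>(y, x). x(Suc m := y)) ` (V \<times> ({..m} \<rightarrow>\<^sub>E V))"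
      unfolding atMost_Suc by (rule PiE_insert_eq)
    have 2: "inj_on (\<lambda>(y, x). x(Suc m := y)) (V \<times> ({..m} \<rightarrow>\<^sub>E V))"
      using inj_combinator[of "Suc m" "{..m}" "\<lambda>_. V"] by simp
    show ?thesis unfolding 1 sum.reindex[OF 2]
    proof (rule sum.cong[OF refl], clarify)
      fix y x
      have "(\<Prod>i<m. N ((x(Suc m := y)) i) ((x(Suc m := y)) (Suc i))) = ?h x"
        by (intro prod.cong) auto
      then show "(if y = v then of_bool (x 0 = u) * ?h x * N (x m) y else 0)
        = ((\<lambda>x. of_bool (x 0 = u \<and> x (Suc m) = v) * (\<Prod>i<Suc m. N (x i) (x (Suc i)))) \<circ> (\<lambda>(y, x). x(Suc m := y))) (y, x)"
        by auto
    qed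
  qed
  finally show ?case .
qed

lemma trace_walks:
  assumes "finite V"
  shows "(\<Sum>u\<in>V. mpow V N m u u) = (\<Sum>x\<in>{..m} \<rightarrow>\<^sub>E V. of_bool (x 0 = x m) * (\<Prod>i<m. N (x i) (x (Suc i))))"
proof -
  let ?h = "\<lambda>x. \<Prod>i<m. N (x i) (x (Suc i))"
  have "(\<Sum>u\<in>V. mpow V N m u u) = (\<Sum>u\<in>V. \<Sum>x\<in>{..m} \<rightarrow>\<^sub>E V. of_bool (x 0 = u \<and> x m = u) * ?h x)"
    using assms by (simp add: mpow_walks)
  also have "\<dots> = (\<Sum>x\<in>{..m} \<rightarrow>\<^sub>E V. \<Sum>u\<in>V. of_bool (x 0 = u \<and> x m = u) * ?h x)"
    by (rule sum.swap)
  also have "\<dots> = (\<Sum>x\<in>{..m} \<rightarrow>\<^sub>E V. of_bool (x 0 = x m) * ?h x)"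
  proof (rule sum.cong[OF refl])
    fix x assume "x \<in> {..m} \<rightarrow>\<^sub>E V"
    then have "x 0 \<in> V" by auto
    have "(\<Sum>u\<in>V. of_bool (x 0 = u \<and> x m = u) * ?h x) = (\<Sum>u\<in>V. if u = x 0 then of_bool (x 0 = x m) * ?h x else 0)"
      by (intro sum.cong) auto
    then show "(\<Sum>u\<in>V. of_bool (x 0 = u \<and> x m = u) * ?h x) = of_bool (x 0 = x m) * ?h x"
      using assms \<open>x 0 \<in> V\<close> by simp
  qed
  finally show ?thesis .
qed

section \<open>The trace method for links\<close>

lemma card_walk_vertices:
  "card (x ` {..m}) \<le> Suc (card ((\<lambda>i. {x i, x (Suc i)}) ` {..<m}))"
proof (induction m)
  case 0
  show ?case by (simp add: atMost_0)
next
  case (Suc m)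
  let ?e = "\<lambda>i. {x i, x (Suc i)}"
  have V: "x ` {..Suc m} = insert (x (Suc m)) (x ` {..m})" by (auto simp: atMost_Suc)
  have E: "?e ` {..<Suc m} = insert (?e m) (?e ` {..<m})" by (auto simp: lessThan_Suc)
  show ?case
  proof (cases "x (Suc m) \<in> x ` {..m}")
    case True
    have "card (?e ` {..<m}) \<le> card (?e ` {..<Suc m})" by (intro card_mono) auto
    then show ?thesis using Suc True V by (simp add: insert_absorb)
  next
    case False
    have "?e m \<notin> ?e ` {..<m}"
    proof
      assume "?e m \<in> ?e ` {..<m}"
      then obtain i where "i < m" "?e m = ?e i" by auto
      then have "x (Suc m) = x i \<or> x (Suc m) = x (Suc i)" by (auto simp: doubleton_eq_iff)
      then show False using False \<open>i < m\<close> by auto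
    qed
    then have "card (?e ` {..<Suc m}) = Suc (card (?e ` {..<m}))" unfolding E by simp
    then show ?thesis using Suc False V by simp
  qed
qed

lemma card_image_double:
  fixes e :: "nat \<Rightarrow> 'b"
  assumes "\<And>d. d \<in> e ` {..<L} \<Longrightarrow> 2 \<le> card {i \<in> {..<L}. e i = d}"
  shows "2 * card (e ` {..<L}) \<le> L"
proof -
  have "2 * card (e ` {..<L}) = (\<Sum>d\<in>e ` {..<L}. 2)" by simp
  also have "\<dots> \<le> (\<Sum>d\<in>e ` {..<L}. card {i \<in> {..<L}. e i = d})"
    using assms by (rule sum_mono)
  also have "\<dots> = (\<Sum>d\<in>e ` {..<L}. \<Sum>i\<in>{i \<in> {..<L}. e i = d}. 1)" by simp
  also have "\<dots> = (\<Sum>i\<in>{..<L}. 1)" by (rule sum.image_gen[symmetric]) simp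
  finally show ?thesis by simp
qed

lemma card_functions_image:
  assumes "finite V"
  shows "card {x \<in> {..L::nat} \<rightarrow>\<^sub>E V. card (x ` {..L}) = v} \<le> card V ^ v * v ^ Suc L"
proof -
  let ?P = "({..<v} \<rightarrow>\<^sub>E V) \<times> ({..L} \<rightarrow>\<^sub>E {..<v})"
  let ?c = "\<lambda>(g, h). restrict (g \<circ> h) {..L}"
  have "{x \<in> {..L} \<rightarrow>\<^sub>E V. card (x ` {..L}) = v} \<subseteq> ?c ` ?P"
  proof
    fix x assume "x \<in> {x \<in> {..L} \<rightarrow>\<^sub>E V. card (x ` {..L}) = v}"
    then have x: "x \<in> {..L} \<rightarrow>\<^sub>E V" "card (x ` {..L}) = v" by auto
    then obtain g where g: "bij_betw g {..<v} (x ` {..L})"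
      using ex_bij_betw_nat_finite[of "x ` {..L}"] by (auto simp: atLeast0LessThan)
    define h where "h = restrict (\<lambda>i. inv_into {..<v} g (x i)) {..L}"
    have gh: "g (h i) = x i" "h i < v" if "i \<le> L" for i
    proof -
      have "x i \<in> g ` {..<v}" using that g by (auto simp: bij_betw_def)
      then show "g (h i) = x i" "h i < v"
        using that f_inv_into_f[of "x i" g "{..<v}"] inv_into_into[of "x i" g "{..<v}"]
        by (auto simp: h_def)
    qed
    have gV: "g j \<in> V" if "j < v" for j
    proof -
      have "g j \<in> x ` {..L}" using g that by (auto simp: bij_betw_def)
      then show ?thesis using x by auto
    qed
    have "x = ?c (restrict g {..<v}, h)"
    proof
      fix i show "x i = ?c (restrict g {..<v}, h) i"
        using gh[of i] PiE_arb[OF x(1), of i] by (cases "i \<le> L") simp_all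
    qed
    moreover have "(restrict g {..<v}, h) \<in> ?P"
      using gV gh by (auto simp: h_def PiE_def)
    ultimately show "x \<in> ?c ` ?P" by blast
  qed
  moreover have fin: "finite ?P" using assms by (intro finite_cartesian_product finite_PiE) auto
  ultimately have "card {x \<in> {..L} \<rightarrow>\<^sub>E V. card (x ` {..L}) = v} \<le> card (?c ` ?P)"
    by (intro card_mono) auto
  also have "\<dots> \<le> card ?P" using fin by (rule card_image_le)
  also have "\<dots> = card V ^ v * v ^ Suc L" by (simp add: card_cartesian_product card_PiE)
  finally show ?thesis .
qed

lemma centered_moment_le:
  fixes p :: real
  assumes "0 \<le> p" "p \<le> 1" "2 \<le> m"
  shows "\<bar>p * (1 - p) ^ m + (1 - p) * (- p) ^ m\<bar> \<le> p"
proof -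
  have "\<bar>p * (1 - p) ^ m + (1 - p) * (- p) ^ m\<bar> \<le> \<bar>p * (1 - p) ^ m\<bar> + \<bar>(1 - p) * (- p) ^ m\<bar>"
    by (rule abs_triangle_ineq)
  also have "\<dots> = p * (1 - p) ^ m + (1 - p) * p ^ m"
    using assms by (simp add: abs_mult power_abs)
  also have "\<dots> \<le> p * (1 - p) ^ 1 + 1 * p ^ 2"
    using assms by (intro add_mono mult_mono power_decreasing) auto
  also have "\<dots> = p" by (simp add: power2_eq_square algebra_simps)
  finally show ?thesis .
qed

definition link_noise :: "nat \<Rightarrow> real \<Rightarrow> nat set \<Rightarrow> nat set \<Rightarrow> nat set set \<Rightarrow> nat \<Rightarrow> nat \<Rightarrow> real" where
  "link_noise n p \<sigma> \<tau> X u v = of_bool (u \<in> ext n X \<sigma> \<tau> \<union> ext n X \<tau> \<sigma>)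
     * of_bool (v \<in> ext n X \<sigma> \<tau> \<union> ext n X \<tau> \<sigma>) * noise p X u v"

lemma depends_on_ext2:
  "depends_on (\<lambda>X. of_bool (v \<in> ext n X \<sigma> \<tau> \<union> ext n X \<tau> \<sigma>)) (star (\<sigma> \<union> \<tau>) v)"
  by (auto simp: depends_on_def ext_def star_def)

lemma bexp_ext2_le:
  assumes "\<sigma> \<subseteq> {1..n}" "\<tau> \<subseteq> {1..n}" "\<sigma> \<inter> \<tau> = {}" "v \<in> {1..n} - \<sigma> - \<tau>" and p: "0 \<le> p" "p \<le> 1"
  shows "bexp (all_edges n) p (\<lambda>X. of_bool (v \<in> ext n X \<sigma> \<tau> \<union> ext n X \<tau> \<sigma>)) \<le> 2 * p ^ min (card \<sigma>) (card \<tau>)"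
proof -
  have "bexp (all_edges n) p (\<lambda>X. of_bool (v \<in> ext n X \<sigma> \<tau> \<union> ext n X \<tau> \<sigma>))
      \<le> bexp (all_edges n) p (\<lambda>X. of_bool (v \<in> ext n X \<sigma> \<tau>) + of_bool (v \<in> ext n X \<tau> \<sigma>))"
    using p by (intro bexp_mono) auto
  also have "\<dots> = p ^ card \<sigma> * (1 - p) ^ card \<tau> + p ^ card \<tau> * (1 - p) ^ card \<sigma>"
    using assms bexp_ext[of \<sigma> n \<tau> v p] bexp_ext[of \<tau> n \<sigma> v p] by (simp add: bexp_add Int_commute)
  also have "\<dots> \<le> p ^ min (card \<sigma>) (card \<tau>) * 1 + p ^ min (card \<sigma>) (card \<tau>) * 1"
    using p by (intro add_mono mult_mono power_decreasing) (auto simp: power_le_one)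
  finally show ?thesis by simp
qed

lemma bexp_nonneg: "0 \<le> p \<Longrightarrow> p \<le> 1 \<Longrightarrow> (\<And>X. X \<subseteq> S \<Longrightarrow> 0 \<le> F X) \<Longrightarrow> 0 \<le> bexp S p F"
  unfolding bexp_def by (intro sum_nonneg mult_nonneg_nonneg) auto

text \<open>A walk contributes only if it traverses every one of its edges at least twice.\<close>

lemma walk_expectation:
  assumes st: "\<sigma> \<subseteq> {1..n}" "\<tau> \<subseteq> {1..n}" "\<sigma> \<inter> \<tau> = {}" and p: "0 \<le> p" "p \<le> 1"
    and x: "x \<in> {..L} \<rightarrow>\<^sub>E {1..n} - \<sigma> - \<tau>" and L: "L \<ge> 1"
  shows "bexp (all_edges n) p (\<lambda>X. \<Prod>i<L. link_noise n p \<sigma> \<tau> X (x i) (x (Suc i)))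
    \<le> of_bool (2 * card (x ` {..L}) \<le> L + 2)
        * ((2 * p ^ min (card \<sigma>) (card \<tau>)) ^ card (x ` {..L}) * p ^ (card (x ` {..L}) - 1))"
proof (cases "\<exists>i<L. x i = x (Suc i)")
  case True
  then obtain i where "i < L" "x i = x (Suc i)" by auto
  then have "(\<Prod>i<L. link_noise n p \<sigma> \<tau> X (x i) (x (Suc i))) = 0" for X
    by (intro prod_zero) (auto simp: link_noise_def noise_def intro!: bexI[of _ i])
  then have "bexp (all_edges n) p (\<lambda>X. \<Prod>i<L. link_noise n p \<sigma> \<tau> X (x i) (x (Suc i))) = bexp (all_edges n) p (\<lambda>_. 0)"
    by (intro bexp_cong)
  then show ?thesis using p by (simp add: bexp_const)
next
  case False
  define V where "V = {1..n} - \<sigma> - \<tau>"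
  define U where "U X = ext n X \<sigma> \<tau> \<union> ext n X \<tau> \<sigma>" for X
  define W where "W = x ` {..L}"
  define e where "e i = {x i, x (Suc i)}" for i
  define D where "D = e ` {..<L}"
  define mult where "mult d = card {i \<in> {..<L}. e i = d}" for d
  define F where "F X = (\<Prod>v\<in>W. of_bool (v \<in> U X) :: real)" for X
  define G where "G X = (\<Prod>d\<in>D. (of_bool (d \<in> X) - p) ^ mult d)" for X
  have finW: "finite W" and finD: "finite D" by (auto simp: W_def D_def)
  have xV: "x i \<in> V" if "i \<le> L" for i using x that by (auto simp: V_def)
  have WV: "W \<subseteq> V" using xV by (auto simp: W_def)
  have DS: "D \<subseteq> all_edges n"
    using False xV by (fastforce simp: D_def e_def all_edges_def V_def card_2_iff)
  have split: "(\<Prod>i<L. link_noise n p \<sigma> \<tau> X (x i) (x (Suc i))) = F X * G X" for X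
  proof -
    have "(\<Prod>i<L. link_noise n p \<sigma> \<tau> X (x i) (x (Suc i)))
        = (\<Prod>i<L. of_bool (x i \<in> U X) * of_bool (x (Suc i) \<in> U X)) * (\<Prod>i<L. noise p X (x i) (x (Suc i)))"
      by (simp add: link_noise_def U_def prod.distrib)
    also have "(\<Prod>i<L. of_bool (x i \<in> U X) * of_bool (x (Suc i) \<in> U X)) = F X"
    proof (cases "\<forall>i\<le>L. x i \<in> U X")
      case True
      then have "(\<Prod>i<L. of_bool (x i \<in> U X) * of_bool (x (Suc i) \<in> U X) :: real) = 1"
        by (intro prod.neutral) auto
      moreover have "F X = 1" unfolding F_def W_def using True by (intro prod.neutral) auto
      ultimately show ?thesis by simp
    next
      case False
      then obtain i where i: "i \<le> L" "x i \<notin> U X" by auto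
      have "F X = 0" unfolding F_def using i finW by (intro prod_zero) (auto simp: W_def)
      moreover have "\<exists>j<L. x j \<notin> U X \<or> x (Suc j) \<notin> U X"
      proof (cases "i < L")
        case True
        then show ?thesis using i by auto
      next
        case False
        then have "i = Suc (L - 1)" "L - 1 < L" using i L by auto
        then show ?thesis using i by metis
      qed
      then have "(\<Prod>i<L. of_bool (x i \<in> U X) * of_bool (x (Suc i) \<in> U X) :: real) = 0"
        by (intro prod_zero) auto
      ultimately show ?thesis by simp
    qed
    also have "(\<Prod>i<L. noise p X (x i) (x (Suc i))) = (\<Prod>i<L. of_bool (e i \<in> X) - p)"
      using False by (intro prod.cong) (auto simp: noise_def e_def)
    also have "\<dots> = (\<Prod>d\<in>D. \<Prod>i\<in>{i \<in> {..<L}. e i = d}. of_bool (e i \<in> X) - p)"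
      unfolding D_def by (rule prod.image_gen) simp
    also have "\<dots> = G X" by (simp add: G_def mult_def)
    finally show ?thesis .
  qed
  have "bexp (all_edges n) p (\<lambda>X. F X * G X) = bexp (all_edges n) p F * bexp (all_edges n) p G"
  proof (rule bexp_mult[of _ "\<Union>v\<in>W. star (\<sigma> \<union> \<tau>) v" D])
    show "(\<Union>v\<in>W. star (\<sigma> \<union> \<tau>) v) \<subseteq> all_edges n"
      using WV st by (intro UN_least star_subset) (auto simp: V_def)
    have "d \<inter> (\<sigma> \<union> \<tau>) = {}" if "d \<in> D" for d
      using that xV by (auto simp: D_def e_def V_def)
    moreover have "d \<inter> (\<sigma> \<union> \<tau>) \<noteq> {}" if "d \<in> star (\<sigma> \<union> \<tau>) v" for d v
      using that by (auto simp: star_def)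
    ultimately show "(\<Union>v\<in>W. star (\<sigma> \<union> \<tau>) v) \<inter> D = {}" by blast
    show "depends_on F (\<Union>v\<in>W. star (\<sigma> \<union> \<tau>) v)"
      unfolding F_def U_def
      by (intro depends_on_prod depends_on_mono[OF depends_on_ext2]) auto
    show "depends_on G D" unfolding G_def depends_on_def by (intro allI prod.cong) auto
  qed (use DS in auto)
  also have "bexp (all_edges n) p F = (\<Prod>v\<in>W. bexp (all_edges n) p (\<lambda>X. of_bool (v \<in> U X)))"
    unfolding F_def
  proof (rule bexp_prod[where A = "star (\<sigma> \<union> \<tau>)"])
    show "star (\<sigma> \<union> \<tau>) v \<subseteq> all_edges n" if "v \<in> W" for v
      using that st WV by (intro star_subset) (auto simp: V_def)
    show "star (\<sigma> \<union> \<tau>) v \<inter> star (\<sigma> \<union> \<tau>) w = {}" if "v \<in> W" "w \<in> W" "v \<noteq> w" for v w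
      using that WV by (intro star_disjoint) (auto simp: V_def)
  qed (use finW depends_on_ext2 in \<open>auto simp: U_def\<close>)
  also have "bexp (all_edges n) p G = (\<Prod>d\<in>D. p * (1 - p) ^ mult d + (1 - p) * (- p) ^ mult d)"
  proof -
    have "bexp (all_edges n) p G = (\<Prod>d\<in>D. bexp (all_edges n) p (\<lambda>X. (of_bool (d \<in> X) - p) ^ mult d))"
      unfolding G_def using finD DS
      by (intro bexp_prod[where A = "\<lambda>d. {d}"]) (auto simp: depends_on_def)
    also have "\<dots> = (\<Prod>d\<in>D. p * (1 - p) ^ mult d + (1 - p) * (- p) ^ mult d)"
    proof (rule prod.cong[OF refl])
      fix d assume "d \<in> D"
      then show "bexp (all_edges n) p (\<lambda>X. (of_bool (d \<in> X) - p) ^ mult d) = p * (1 - p) ^ mult d + (1 - p) * (- p) ^ mult d"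
        using bexp_single[of "all_edges n" d p "\<lambda>b. (of_bool b - p) ^ mult d"] DS by auto
    qed
    finally show ?thesis .
  qed
  finally have eq: "bexp (all_edges n) p (\<lambda>X. \<Prod>i<L. link_noise n p \<sigma> \<tau> X (x i) (x (Suc i)))
      = (\<Prod>v\<in>W. bexp (all_edges n) p (\<lambda>X. of_bool (v \<in> U X)))
        * (\<Prod>d\<in>D. p * (1 - p) ^ mult d + (1 - p) * (- p) ^ mult d)"
    by (simp add: split)
  have mult_pos: "mult d \<ge> 1" if "d \<in> D" for d
  proof -
    have "{i \<in> {..<L}. e i = d} \<noteq> {}" using that by (auto simp: D_def)
    then have "card {i \<in> {..<L}. e i = d} > 0" by (subst card_gt_0_iff) auto
    then show ?thesis by (simp add: mult_def)
  qed
  show ?thesis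
  proof (cases "\<forall>d\<in>D. 2 \<le> mult d")
    case False
    then obtain d where d: "d \<in> D" "mult d = 1" using mult_pos by force
    then have "(\<Prod>d\<in>D. p * (1 - p) ^ mult d + (1 - p) * (- p) ^ mult d) = 0"
      using finD by (intro prod_zero) (auto intro!: bexI[of _ d])
    then show ?thesis unfolding eq using p by simp
  next
    case True
    have D2: "2 * card D \<le> L"
      unfolding D_def using True by (intro card_image_double) (auto simp: D_def mult_def)
    have WD: "card W \<le> Suc (card D)"
      unfolding W_def D_def e_def by (rule card_walk_vertices)
    have "\<bar>\<Prod>d\<in>D. p * (1 - p) ^ mult d + (1 - p) * (- p) ^ mult d\<bar> \<le> (\<Prod>d\<in>D. p)"
      unfolding abs_prod using True centered_moment_le[OF p] by (intro prod_mono) auto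
    also have "\<dots> \<le> p ^ (card W - 1)" using WD p by (auto intro: power_decreasing)
    finally have A: "(\<Prod>d\<in>D. p * (1 - p) ^ mult d + (1 - p) * (- p) ^ mult d) \<le> p ^ (card W - 1)" by simp
    have nn: "bexp (all_edges n) p (\<lambda>X. of_bool (v \<in> U X)) \<ge> 0" for v
      using p by (intro bexp_nonneg) auto
    have B: "(\<Prod>v\<in>W. bexp (all_edges n) p (\<lambda>X. of_bool (v \<in> U X))) \<le> (\<Prod>v\<in>W. 2 * p ^ min (card \<sigma>) (card \<tau>))"
      using nn WV st p unfolding U_def V_def by (intro prod_mono conjI bexp_ext2_le) auto
    have "(\<Prod>v\<in>W. bexp (all_edges n) p (\<lambda>X. of_bool (v \<in> U X)))
        * (\<Prod>d\<in>D. p * (1 - p) ^ mult d + (1 - p) * (- p) ^ mult d)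
      \<le> (\<Prod>v\<in>W. bexp (all_edges n) p (\<lambda>X. of_bool (v \<in> U X))) * p ^ (card W - 1)"
      using A nn by (intro mult_left_mono prod_nonneg) auto
    also have "\<dots> \<le> (\<Prod>v\<in>W. 2 * p ^ min (card \<sigma>) (card \<tau>)) * p ^ (card W - 1)"
      using B p by (intro mult_right_mono) auto
    finally show ?thesis unfolding eq using D2 WD by (simp add: W_def)
  qed
qed

lemma trace_expectation:
  assumes st: "\<sigma> \<subseteq> {1..n}" "\<tau> \<subseteq> {1..n}" "\<sigma> \<inter> \<tau> = {}" and p: "0 \<le> p" "p \<le> 1"
    and L: "L = 2 * h" "h \<ge> 1"
    and M: "M \<ge> 1" "real n * p ^ Suc (min (card \<sigma>) (card \<tau>)) \<le> M"
  shows "bexp (all_edges n) p (\<lambda>X. \<Sum>u\<in>{1..n} - \<sigma> - \<tau>. mpow ({1..n} - \<sigma> - \<tau>) (link_noise n p \<sigma> \<tau> X) L u u)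
    \<le> real (Suc L) ^ (L + 2) * 2 ^ Suc L * (real n * M ^ h)"
proof -
  define V where "V = {1..n} - \<sigma> - \<tau>"
  define c where "c = min (card \<sigma>) (card \<tau>)"
  define P where "P = {..L} \<rightarrow>\<^sub>E V"
  define \<phi> where "\<phi> v = of_bool (2 * v \<le> L + 2) * ((2 * p ^ c) ^ v * p ^ (v - 1))" for v :: nat
  have finV: "finite V" by (simp add: V_def)
  have cardV: "card V \<le> n" using card_mono[of "{1..n}" V] by (auto simp: V_def)
  have finP: "finite P" unfolding P_def using finV by (intro finite_PiE) auto
  have phi_nn: "\<phi> v \<ge> 0" for v using p by (simp add: \<phi>_def)
  have "bexp (all_edges n) p (\<lambda>X. \<Sum>u\<in>V. mpow V (link_noise n p \<sigma> \<tau> X) L u u)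
      = (\<Sum>x\<in>P. bexp (all_edges n) p (\<lambda>X. of_bool (x 0 = x L) * (\<Prod>i<L. link_noise n p \<sigma> \<tau> X (x i) (x (Suc i)))))"
    unfolding trace_walks[OF finV] P_def by (rule bexp_sum)
  also have "\<dots> \<le> (\<Sum>x\<in>P. \<phi> (card (x ` {..L})))"
  proof (rule sum_mono)
    fix x assume "x \<in> P"
    then have "bexp (all_edges n) p (\<lambda>X. \<Prod>i<L. link_noise n p \<sigma> \<tau> X (x i) (x (Suc i))) \<le> \<phi> (card (x ` {..L}))"
      unfolding \<phi>_def c_def using L by (intro walk_expectation[OF st p]) (auto simp: P_def V_def)
    then show "bexp (all_edges n) p (\<lambda>X. of_bool (x 0 = x L) * (\<Prod>i<L. link_noise n p \<sigma> \<tau> X (x i) (x (Suc i))))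
        \<le> \<phi> (card (x ` {..L}))"
      using phi_nn by (auto simp: bexp_cmult)
  qed
  also have "\<dots> = (\<Sum>v\<in>{1..Suc L}. \<Sum>x\<in>{x \<in> P. card (x ` {..L}) = v}. \<phi> (card (x ` {..L})))"
  proof (rule sum.group[symmetric])
    have "card (x ` {..L}) \<le> Suc L" "card (x ` {..L}) \<ge> 1" for x :: "nat \<Rightarrow> nat"
      using card_image_le[of "{..L}" x] card_gt_0_iff[of "x ` {..L}"] by auto
    then show "(\<lambda>x. card (x ` {..L})) ` P \<subseteq> {1..Suc L}" by auto
  qed (use finP in auto)
  also have "\<dots> = (\<Sum>v\<in>{1..Suc L}. real (card {x \<in> P. card (x ` {..L}) = v}) * \<phi> v)"
    by (intro sum.cong refl) auto
  also have "\<dots> \<le> (\<Sum>v\<in>{1..Suc L}. real (Suc L) ^ Suc L * 2 ^ Suc L * (real n * M ^ h))"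
  proof (rule sum_mono)
    fix v assume v: "v \<in> {1..Suc L}"
    have R: "0 \<le> real (Suc L) ^ Suc L * 2 ^ Suc L * (real n * M ^ h)" using M by simp
    show "real (card {x \<in> P. card (x ` {..L}) = v}) * \<phi> v \<le> real (Suc L) ^ Suc L * 2 ^ Suc L * (real n * M ^ h)"
    proof (cases "2 * v \<le> L + 2")
      case False
      then show ?thesis using R by (simp add: \<phi>_def)
    next
      case True
      then have vh: "v - 1 \<le> h" using L by simp
      have "card {x \<in> P. card (x ` {..L}) = v} \<le> n ^ v * Suc L ^ Suc L"
      proof -
        have "card {x \<in> P. card (x ` {..L}) = v} \<le> card V ^ v * v ^ Suc L"
          unfolding P_def by (rule card_functions_image[OF finV])
        also have "\<dots> \<le> n ^ v * Suc L ^ Suc L"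
          using cardV v by (intro mult_mono power_mono) auto
        finally show ?thesis .
      qed
      then have "real (card {x \<in> P. card (x ` {..L}) = v}) \<le> real (n ^ v * Suc L ^ Suc L)"
        by (rule of_nat_mono)
      then have "real (card {x \<in> P. card (x ` {..L}) = v}) \<le> real n ^ v * real (Suc L) ^ Suc L"
        by (simp only: of_nat_mult of_nat_power)
      then have "real (card {x \<in> P. card (x ` {..L}) = v}) * \<phi> v \<le> (real n ^ v * real (Suc L) ^ Suc L) * ((2 * p ^ c) ^ v * p ^ (v - 1))"
        by (rule mult_mono) (use True p in \<open>auto simp: \<phi>_def\<close>)
      also have "\<dots> = real (Suc L) ^ Suc L * 2 ^ v * (real n * (p ^ c * (real n * p ^ Suc c) ^ (v - 1)))"
      proof -
        obtain w where w: "v = Suc w" using v by (cases v) auto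
        show ?thesis unfolding w by (simp add: power_mult_distrib mult_ac del: of_nat_Suc)
      qed
      also have "\<dots> \<le> real (Suc L) ^ Suc L * 2 ^ Suc L * (real n * M ^ h)"
      proof -
        have "(real n * p ^ Suc c) ^ (v - 1) \<le> M ^ (v - 1)"
          using M p by (intro power_mono) (auto simp: c_def)
        also have "\<dots> \<le> M ^ h" using M vh by (intro power_increasing) auto
        finally have "p ^ c * (real n * p ^ Suc c) ^ (v - 1) \<le> 1 * M ^ h"
          using p by (intro mult_mono) (auto simp: power_le_one)
        moreover have "(2::real) ^ v \<le> 2 ^ Suc L" using v by (intro power_increasing) auto
        ultimately show ?thesis using p M
          by (intro mult_mono) auto
      qed
      finally show ?thesis .
    qed
  qed
  also have "\<dots> = real (Suc L) ^ (L + 2) * 2 ^ Suc L * (real n * M ^ h)" by (simp add: mult_ac)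
  finally show ?thesis by (simp add: V_def)
qed

text \<open>Markov's inequality for the trace of a high even power of the noise matrix.\<close>

lemma noise_tail:
  assumes st: "\<sigma> \<subseteq> {1..n}" "\<tau> \<subseteq> {1..n}" "\<sigma> \<inter> \<tau> = {}" and p: "0 \<le> p" "p \<le> 1"
    and L: "L = 2 ^ Suc j" and B: "B > 0"
    and M: "M \<ge> 1" "real n * p ^ Suc (min (card \<sigma>) (card \<tau>)) \<le> M"
  shows "bexp (all_edges n) p (\<lambda>X. of_bool (\<exists>g. B * (\<Sum>v\<in>ext n X \<sigma> \<tau> \<union> ext n X \<tau> \<sigma>. (g v)\<^sup>2)
        < (\<Sum>u\<in>ext n X \<sigma> \<tau> \<union> ext n X \<tau> \<sigma>. \<Sum>v\<in>ext n X \<sigma> \<tau> \<union> ext n X \<tau> \<sigma>. noise p X u v * (g u * g v))))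
    \<le> real (Suc L) ^ (L + 2) * 2 ^ Suc L * (real n * M ^ (2 ^ j)) / B ^ L"
proof -
  define V where "V = {1..n} - \<sigma> - \<tau>"
  define U where "U X = ext n X \<sigma> \<tau> \<union> ext n X \<tau> \<sigma>" for X
  define T where "T X = (\<Sum>u\<in>V. mpow V (link_noise n p \<sigma> \<tau> X) L u u)" for X
  have finV: "finite V" by (simp add: V_def)
  have UV: "U X \<subseteq> V" for X by (auto simp: U_def V_def ext_def)
  have sym: "\<forall>u v. link_noise n p \<sigma> \<tau> X u v = link_noise n p \<sigma> \<tau> X v u" for X
    by (auto simp: link_noise_def noise_def insert_commute)
  note le_trace = qform_power_le_trace[OF finV sym L, folded T_def]
  have L0: "L > 0" using L by simp
  have T_nonneg: "T X \<ge> 0" for X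
  proof (cases "V = {}")
    case True
    then show ?thesis by (simp add: T_def)
  next
    case False
    then obtain v0 where v0: "v0 \<in> V" by auto
    have "(\<Sum>v\<in>V. (of_bool (v = v0) :: real)\<^sup>2) = (\<Sum>v\<in>V. if v = v0 then 1 else 0)"
      by (intro sum.cong) auto
    then have "(\<Sum>v\<in>V. (of_bool (v = v0) :: real)\<^sup>2) = 1" using v0 finV by simp
    then have "\<bar>qform V (link_noise n p \<sigma> \<tau> X) (\<lambda>v. of_bool (v = v0))\<bar> ^ L \<le> T X"
      using le_trace[of X "\<lambda>v. of_bool (v = v0)"] by simp
    then show ?thesis using order_trans[OF zero_le_power[OF abs_ge_zero]] by blast
  qed
  have "of_bool (\<exists>g. B * (\<Sum>v\<in>U X. (g v)\<^sup>2) < (\<Sum>u\<in>U X. \<Sum>v\<in>U X. noise p X u v * (g u * g v))) \<le> (1 / B ^ L) * T X" for X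
  proof (cases "\<exists>g. B * (\<Sum>v\<in>U X. (g v)\<^sup>2) < (\<Sum>u\<in>U X. \<Sum>v\<in>U X. noise p X u v * (g u * g v))")
    case False
    then show ?thesis using T_nonneg B by simp
  next
    case True
    then obtain g where g: "B * (\<Sum>v\<in>U X. (g v)\<^sup>2) < (\<Sum>u\<in>U X. \<Sum>v\<in>U X. noise p X u v * (g u * g v))"
      by auto
    define g' where "g' v = of_bool (v \<in> U X) * g v" for v
    define G where "G = (\<Sum>v\<in>U X. (g v)\<^sup>2)"
    define q where "q = (\<Sum>u\<in>U X. \<Sum>v\<in>U X. noise p X u v * (g u * g v))"
    have G': "(\<Sum>v\<in>V. (g' v)\<^sup>2) = G"
      unfolding G_def using finV UV by (intro sum.mono_neutral_cong_right) (auto simp: g'_def)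
    have "qform V (link_noise n p \<sigma> \<tau> X) g' = (\<Sum>u\<in>U X. \<Sum>v\<in>V. link_noise n p \<sigma> \<tau> X u v * (g' u * g' v))"
      unfolding qform_def using finV UV by (intro sum.mono_neutral_right) (auto simp: g'_def)
    also have "\<dots> = q" unfolding q_def
    proof (rule sum.cong[OF refl])
      fix u assume "u \<in> U X"
      then show "(\<Sum>v\<in>V. link_noise n p \<sigma> \<tau> X u v * (g' u * g' v)) = (\<Sum>v\<in>U X. noise p X u v * (g u * g v))"
        using finV UV by (intro sum.mono_neutral_cong_right) (auto simp: g'_def link_noise_def U_def)
    qed
    finally have q': "qform V (link_noise n p \<sigma> \<tau> X) g' = q" .
    have G0: "G \<ge> 0" by (simp add: G_def sum_nonneg)
    have Bq: "B * G < q" using g by (simp add: G_def q_def)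
    have BG: "0 \<le> B * G" using B G0 by simp
    have "(B * G) ^ L < q ^ L" using Bq BG L0 by (intro power_strict_mono) auto
    also have "q ^ L \<le> G ^ L * T X"
      using le_trace[of X g'] Bq BG by (simp add: q' G')
    finally have lt: "(B * G) ^ L < G ^ L * T X" .
    then have "G \<noteq> 0" using L0 by (auto simp: power_0_left)
    then have "G > 0" using G0 by simp
    then have "B ^ L < T X" using lt by (simp add: power_mult_distrib mult.commute)
    then show ?thesis using True B by (simp add: field_simps)
  qed
  then have "bexp (all_edges n) p (\<lambda>X. of_bool (\<exists>g. B * (\<Sum>v\<in>U X. (g v)\<^sup>2) < (\<Sum>u\<in>U X. \<Sum>v\<in>U X. noise p X u v * (g u * g v))))
      \<le> bexp (all_edges n) p (\<lambda>X. (1 / B ^ L) * T X)"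
    using p by (intro bexp_mono) auto
  also have "\<dots> = (1 / B ^ L) * bexp (all_edges n) p T" by (rule bexp_cmult)
  also have "\<dots> \<le> (1 / B ^ L) * (real (Suc L) ^ (L + 2) * 2 ^ Suc L * (real n * M ^ (2 ^ j)))"
    unfolding T_def V_def using B L
    by (intro mult_left_mono trace_expectation[OF st p _ _ M]) auto
  finally show ?thesis by (simp add: U_def)
qed

section \<open>Union bound and asymptotics\<close>

lemma eventually_const_mult_powr_le:
  fixes K C :: real
  shows "eventually (\<lambda>n::nat. K * real n powr (- C - 1) \<le> real n powr (- C) / 2) at_top"
proof -
  have "((\<lambda>n::nat. K / real n) \<longlongrightarrow> 0) at_top" by real_asymp
  then have "eventually (\<lambda>n::nat. K / real n < 1 / 2) at_top" by (rule order_tendstoD) simp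
  then show ?thesis using eventually_gt_at_top[of 0]
  proof eventually_elim
    case (elim n)
    have "K * real n powr (- C - 1) = (K / real n) * real n powr (- C)"
      using elim by (simp add: powr_diff)
    also have "\<dots> \<le> (1 / 2) * real n powr (- C)" using elim by (intro mult_right_mono) auto
    finally show ?case by simp
  qed
qed

lemma eventually_power_mult_exp_le:
  fixes \<delta> C K :: real
  assumes "\<delta> > 0"
  shows "eventually (\<lambda>n::nat. K * (real n ^ m * exp (- (real n powr \<delta>) / 16)) \<le> real n powr (- C) / 2) at_top"
proof -
  have "((\<lambda>n::nat. K * (real n powr (real m + C) * exp (- (real n powr \<delta>) / 16))) \<longlongrightarrow> 0) at_top"
    using assms by real_asymp
  then have "eventually (\<lambda>n::nat. K * (real n powr (real m + C) * exp (- (real n powr \<delta>) / 16)) < 1 / 2) at_top"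
    by (rule order_tendstoD) simp
  then show ?thesis using eventually_gt_at_top[of 0]
  proof eventually_elim
    case (elim n)
    have "K * (real n ^ m * exp (- (real n powr \<delta>) / 16)) = (K * (real n powr (real m + C) * exp (- (real n powr \<delta>) / 16))) * real n powr (- C)"
      using elim by (simp add: powr_add powr_realpow powr_minus)
    also have "\<dots> \<le> (1 / 2) * real n powr (- C)" using elim by (intro mult_right_mono) auto
    finally show ?case by simp
  qed
qed

definition disjoint_pairs :: "nat \<Rightarrow> nat \<Rightarrow> (nat set \<times> nat set) set" where
  "disjoint_pairs n s = {(\<sigma>, \<tau>). \<sigma> \<subseteq> {1..n} \<and> \<tau> \<subseteq> {1..n} \<and> \<sigma> \<inter> \<tau> = {} \<and> card \<sigma> + card \<tau> = s}"

lemma finite_disjoint_pairs [simp]: "finite (disjoint_pairs n s)"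
  by (rule finite_subset[of _ "Pow {1..n} \<times> Pow {1..n}"]) (auto simp: disjoint_pairs_def)

lemma card_disjoint_pairs: "card (disjoint_pairs n s) \<le> Suc s * n ^ s"
proof -
  define S where "S a = {\<sigma>. \<sigma> \<subseteq> {1..n} \<and> card \<sigma> = a}" for a
  have fin: "finite (S a)" for a
    by (rule finite_subset[of _ "Pow {1..n}"]) (auto simp: S_def)
  have cS: "card (S a) \<le> n ^ a" for a
  proof -
    have "card (S a) = n choose a" using n_subsets[of "{1..n}" a] by (simp add: S_def)
    also have "\<dots> \<le> n ^ a" by (cases "a \<le> n") (auto simp: binomial_le_pow binomial_eq_0)
    finally show ?thesis .
  qed
  have "disjoint_pairs n s \<subseteq> (\<Union>a\<in>{..s}. S a \<times> S (s - a))"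
    by (auto simp: disjoint_pairs_def S_def)
  then have "card (disjoint_pairs n s) \<le> card (\<Union>a\<in>{..s}. S a \<times> S (s - a))"
    using fin by (intro card_mono) auto
  also have "\<dots> \<le> (\<Sum>a\<in>{..s}. card (S a \<times> S (s - a)))" by (rule card_UN_le) simp
  also have "\<dots> \<le> (\<Sum>a\<in>{..s}. n ^ s)"
  proof (rule sum_mono)
    fix a assume "a \<in> {..s}"
    then have "n ^ a * n ^ (s - a) = n ^ s" by (simp flip: power_add)
    then show "card (S a \<times> S (s - a)) \<le> n ^ s"
      using mult_mono[OF cS[of a] cS[of "s - a"]] by (simp add: card_cartesian_product)
  qed
  finally show ?thesis by simp
qed

lemma failure_probability:
  fixes p :: real
  assumes k: "1 \<le> k" "k \<le> 2 * d" and p: "0 < p" "p \<le> 1/3" and npd: "real n * p ^ d \<ge> 1"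
    and pk: "(1 - p) ^ Suc k \<ge> 1/2" and n: "n \<ge> 2 * Suc k"
    and \<mu>: "\<mu> = 1 / (64 * real (Suc k))" and L: "L = 2 ^ Suc j"
  shows "1 - prob_Gnp n p (\<lambda>E. rat_homology_vanishes (Ztilde n E) k)
    \<le> real (Suc k * n ^ k) * (real (Suc L) ^ (L + 2) * 2 ^ Suc L * real n / (\<mu> ^ L * (real n * p ^ d) ^ (2 ^ j)))
      + real (Suc (Suc k) * n ^ Suc k) * exp (- (real n * p ^ d) / 16)"
proof -
  define b1 where "b1 X \<sigma> \<tau> \<longleftrightarrow> (\<exists>g. \<mu> * (real n * (p ^ max (card \<sigma>) (card \<tau>) + p ^ Suc (min (card \<sigma>) (card \<tau>))))
      * (\<Sum>v\<in>ext n X \<sigma> \<tau> \<union> ext n X \<tau> \<sigma>. (g v)\<^sup>2)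
        < (\<Sum>u\<in>ext n X \<sigma> \<tau> \<union> ext n X \<tau> \<sigma>. \<Sum>v\<in>ext n X \<sigma> \<tau> \<union> ext n X \<tau> \<sigma>. noise p X u v * (g u * g v)))"
    for X \<sigma> \<tau>
  define b2 where "b2 X \<sigma> \<tau> \<longleftrightarrow> card \<sigma> \<le> card \<tau> \<and> real (card (ext n X \<sigma> \<tau>)) \<le> real n * p ^ card \<sigma> / 16" for X \<sigma> \<tau>
  have p1: "0 \<le> p" "p \<le> 1" using p by auto
  have n1: "n \<ge> 1" using n by simp
  have \<mu>0: "\<mu> > 0" using \<mu> by simp
  have good: "rat_homology_vanishes (Ztilde n X) k"
    if g1: "\<forall>(\<sigma>, \<tau>)\<in>disjoint_pairs n k. \<not> b1 X \<sigma> \<tau>" and g2: "\<forall>(\<sigma>, \<tau>)\<in>disjoint_pairs n (Suc k). \<not> b2 X \<sigma> \<tau>" for X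
  proof (rule Ztilde_vanishing[OF k(1) p n1 less_imp_le[OF \<mu>0]])
    fix \<sigma> \<tau> g assume "\<sigma> \<subseteq> {1..n}" "\<tau> \<subseteq> {1..n}" "\<sigma> \<inter> \<tau> = {}" "card \<sigma> + card \<tau> = k"
    then have "\<not> b1 X \<sigma> \<tau>" using g1 by (auto simp: disjoint_pairs_def)
    then show "(\<Sum>u\<in>ext n X \<sigma> \<tau> \<union> ext n X \<tau> \<sigma>. \<Sum>v\<in>ext n X \<sigma> \<tau> \<union> ext n X \<tau> \<sigma>. noise p X u v * (g u * g v))
        \<le> \<mu> * (real n * (p ^ max (card \<sigma>) (card \<tau>) + p ^ Suc (min (card \<sigma>) (card \<tau>))))
            * (\<Sum>v\<in>ext n X \<sigma> \<tau> \<union> ext n X \<tau> \<sigma>. (g v)\<^sup>2)"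
      unfolding b1_def not_ex not_less by blast
  next
    have *: "\<mu> * real (Suc k) * (real n * (p ^ card \<sigma> + p ^ card \<tau>))
        < real (card (ext n X \<sigma> \<tau>)) + real (card (ext n X \<tau> \<sigma>))"
      if st: "\<sigma> \<subseteq> {1..n}" "\<tau> \<subseteq> {1..n}" "\<sigma> \<inter> \<tau> = {}" "card \<sigma> + card \<tau> = Suc k" "card \<sigma> \<le> card \<tau>" for \<sigma> \<tau>
    proof -
      have "(\<sigma>, \<tau>) \<in> disjoint_pairs n (Suc k)" using st by (auto simp: disjoint_pairs_def)
      then have "\<not> b2 X \<sigma> \<tau>" using g2 by blast
      then have lt: "real n * p ^ card \<sigma> / 16 < real (card (ext n X \<sigma> \<tau>))"
        using st(5) by (simp add: b2_def)
      have "p ^ card \<tau> \<le> p ^ card \<sigma>" using p1 st(5) by (rule power_decreasing[rotated])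
      then have "real n * (p ^ card \<sigma> + p ^ card \<tau>) \<le> real n * (2 * p ^ card \<sigma>)"
        by (intro mult_left_mono) auto
      moreover have "\<mu> * real (Suc k) = 1 / 64" unfolding \<mu> by simp
      ultimately have "\<mu> * real (Suc k) * (real n * (p ^ card \<sigma> + p ^ card \<tau>)) \<le> real n * p ^ card \<sigma> / 32"
        by (simp only:)
      also have "\<dots> \<le> real n * p ^ card \<sigma> / 16" using p1 by (simp add: field_simps)
      finally show ?thesis using lt by simp
    qed
    fix \<sigma> \<tau> assume st: "\<sigma> \<subseteq> {1..n}" "\<tau> \<subseteq> {1..n}" "\<sigma> \<inter> \<tau> = {}" "card \<sigma> + card \<tau> = Suc k"
    show "\<mu> * real (Suc k) * (real n * (p ^ card \<sigma> + p ^ card \<tau>))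
        < real (card (ext n X \<sigma> \<tau>)) + real (card (ext n X \<tau> \<sigma>))"
    proof (cases "card \<sigma> \<le> card \<tau>")
      case True
      then show ?thesis using *[OF st] by simp
    next
      case False
      then show ?thesis using *[of \<tau> \<sigma>] st by (simp add: Int_commute add.commute)
    qed
  qed
  have "1 - prob_Gnp n p (\<lambda>E. rat_homology_vanishes (Ztilde n E) k)
      = bexp (all_edges n) p (\<lambda>X. of_bool (\<not> rat_homology_vanishes (Ztilde n X) k))"
    by (rule prob_compl)
  also have "\<dots> \<le> bexp (all_edges n) p (\<lambda>X. (\<Sum>(\<sigma>, \<tau>)\<in>disjoint_pairs n k. of_bool (b1 X \<sigma> \<tau>))
        + (\<Sum>(\<sigma>, \<tau>)\<in>disjoint_pairs n (Suc k). of_bool (b2 X \<sigma> \<tau>)))"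
  proof (rule bexp_mono[OF p1])
    fix X :: "nat set set"
    have ge1: "1 \<le> (\<Sum>(\<sigma>, \<tau>)\<in>S. of_bool (Q \<sigma> \<tau>) :: real)"
      if "finite S" "(\<sigma>, \<tau>) \<in> S" "Q \<sigma> \<tau>" for S :: "(nat set \<times> nat set) set" and Q \<sigma> \<tau>
    proof -
      have "(\<lambda>(\<sigma>, \<tau>). of_bool (Q \<sigma> \<tau>) :: real) (\<sigma>, \<tau>) \<le> (\<Sum>(\<sigma>, \<tau>)\<in>S. of_bool (Q \<sigma> \<tau>))"
        using that(1,2) by (intro member_le_sum) auto
      then show ?thesis using that(3) by simp
    qed
    have ge0: "0 \<le> (\<Sum>(\<sigma>, \<tau>)\<in>S. of_bool (Q \<sigma> \<tau>) :: real)" for S :: "(nat set \<times> nat set) set" and Q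
      by (intro sum_nonneg) auto
    show "of_bool (\<not> rat_homology_vanishes (Ztilde n X) k)
      \<le> (\<Sum>(\<sigma>, \<tau>)\<in>disjoint_pairs n k. of_bool (b1 X \<sigma> \<tau>) :: real)
        + (\<Sum>(\<sigma>, \<tau>)\<in>disjoint_pairs n (Suc k). of_bool (b2 X \<sigma> \<tau>))"
    proof (cases "rat_homology_vanishes (Ztilde n X) k")
      case True
      then show ?thesis using ge0 by (simp add: add_nonneg_nonneg)
    next
      case False
      then consider \<sigma> \<tau> where "(\<sigma>, \<tau>) \<in> disjoint_pairs n k" "b1 X \<sigma> \<tau>"
        | \<sigma> \<tau> where "(\<sigma>, \<tau>) \<in> disjoint_pairs n (Suc k)" "b2 X \<sigma> \<tau>"
        using good[of X] by blast
      then show ?thesis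
      proof cases
        case 1
        then show ?thesis
          using False ge1[of "disjoint_pairs n k" \<sigma> \<tau> "b1 X"] ge0[of "b2 X" "disjoint_pairs n (Suc k)"] by simp
      next
        case 2
        then show ?thesis
          using False ge1[of "disjoint_pairs n (Suc k)" \<sigma> \<tau> "b2 X"] ge0[of "b1 X" "disjoint_pairs n k"] by simp
      qed
    qed
  qed
  also have "\<dots> = (\<Sum>(\<sigma>, \<tau>)\<in>disjoint_pairs n k. bexp (all_edges n) p (\<lambda>X. of_bool (b1 X \<sigma> \<tau>)))
        + (\<Sum>(\<sigma>, \<tau>)\<in>disjoint_pairs n (Suc k). bexp (all_edges n) p (\<lambda>X. of_bool (b2 X \<sigma> \<tau>)))"
    unfolding bexp_add bexp_sum case_prod_unfold ..
  also have "\<dots> \<le> real (Suc k * n ^ k) * (real (Suc L) ^ (L + 2) * 2 ^ Suc L * real n / (\<mu> ^ L * (real n * p ^ d) ^ (2 ^ j)))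
      + real (Suc (Suc k) * n ^ Suc k) * exp (- (real n * p ^ d) / 16)"
  proof (rule add_mono)
    let ?c = "real (Suc L) ^ (L + 2) * 2 ^ Suc L"
    let ?b = "?c * real n / (\<mu> ^ L * (real n * p ^ d) ^ (2 ^ j))"
    have b: "bexp (all_edges n) p (\<lambda>X. of_bool (b1 X \<sigma> \<tau>)) \<le> ?b"
      if "(\<sigma>, \<tau>) \<in> disjoint_pairs n k" for \<sigma> \<tau>
    proof -
      have st: "\<sigma> \<subseteq> {1..n}" "\<tau> \<subseteq> {1..n}" "\<sigma> \<inter> \<tau> = {}" "card \<sigma> + card \<tau> = k"
        using that by (auto simp: disjoint_pairs_def)
      define \<beta> where "\<beta> = real n * (p ^ max (card \<sigma>) (card \<tau>) + p ^ Suc (min (card \<sigma>) (card \<tau>)))"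
      have "p ^ d \<le> p ^ max (card \<sigma>) (card \<tau>) + p ^ Suc (min (card \<sigma>) (card \<tau>))"
      proof (cases "Suc (min (card \<sigma>) (card \<tau>)) \<le> d")
        case True
        then have "p ^ d \<le> p ^ Suc (min (card \<sigma>) (card \<tau>))" using p1 by (intro power_decreasing)
        then show ?thesis using p1 by (simp add: add_increasing)
      next
        case False
        then have "max (card \<sigma>) (card \<tau>) \<le> d" using st(4) k(2) by (auto simp: min_def max_def split: if_splits)
        then have "p ^ d \<le> p ^ max (card \<sigma>) (card \<tau>)" using p1 by (intro power_decreasing)
        then show ?thesis using p1 by (simp add: add_increasing2)
      qed
      then have \<beta>d: "real n * p ^ d \<le> \<beta>" unfolding \<beta>_def by (intro mult_left_mono) auto
      then have \<beta>1: "\<beta> \<ge> 1" using npd by simp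
      have \<beta>M: "real n * p ^ Suc (min (card \<sigma>) (card \<tau>)) \<le> \<beta>"
        unfolding \<beta>_def using p1 by (intro mult_left_mono) auto
      have "bexp (all_edges n) p (\<lambda>X. of_bool (b1 X \<sigma> \<tau>)) \<le> ?c * (real n * \<beta> ^ (2 ^ j)) / (\<mu> * \<beta>) ^ L"
        unfolding b1_def \<beta>_def[symmetric] using \<mu>0 \<beta>1
        by (intro noise_tail[OF st(1-3) p1 L _ \<beta>1 \<beta>M]) auto
      also have "\<dots> = ?c * real n / (\<mu> ^ L * \<beta> ^ (2 ^ j))"
      proof -
        have "\<beta> ^ L = \<beta> ^ (2 ^ j) * \<beta> ^ (2 ^ j)" by (simp add: L flip: power_add mult_2)
        then show ?thesis using \<beta>1 by (simp add: power_mult_distrib)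
      qed
      also have "\<dots> \<le> ?b"
        using \<mu>0 npd \<beta>d by (intro divide_left_mono mult_left_mono power_mono mult_pos_pos) auto
      finally show ?thesis .
    qed
    have "(\<Sum>(\<sigma>, \<tau>)\<in>disjoint_pairs n k. bexp (all_edges n) p (\<lambda>X. of_bool (b1 X \<sigma> \<tau>)))
        \<le> (\<Sum>_\<in>disjoint_pairs n k. ?b)"
      using b by (intro sum_mono) auto
    also have "\<dots> = real (card (disjoint_pairs n k)) * ?b" by simp
    also have "\<dots> \<le> real (Suc k * n ^ k) * ?b"
      using \<mu>0 p1 by (intro mult_right_mono of_nat_mono card_disjoint_pairs) simp
    finally show "(\<Sum>(\<sigma>, \<tau>)\<in>disjoint_pairs n k. bexp (all_edges n) p (\<lambda>X. of_bool (b1 X \<sigma> \<tau>))) \<le> real (Suc k * n ^ k) * ?b" .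
  next
    let ?b = "exp (- (real n * p ^ d) / 16)"
    have b: "bexp (all_edges n) p (\<lambda>X. of_bool (b2 X \<sigma> \<tau>)) \<le> ?b"
      if "(\<sigma>, \<tau>) \<in> disjoint_pairs n (Suc k)" for \<sigma> \<tau>
    proof (cases "card \<sigma> \<le> card \<tau>")
      case False
      then show ?thesis by (simp add: b2_def bexp_const)
    next
      case True
      have st: "\<sigma> \<subseteq> {1..n}" "\<tau> \<subseteq> {1..n}" "\<sigma> \<inter> \<tau> = {}" "card \<sigma> + card \<tau> = Suc k"
        using that by (auto simp: disjoint_pairs_def)
      have "card \<sigma> \<le> d" using True st(4) k(2) by linarith
      then have pd: "p ^ d \<le> p ^ card \<sigma>" using p1 by (intro power_decreasing)
      have "1/2 \<le> (1 - p) ^ Suc k" by (rule pk)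
      also have "\<dots> \<le> (1 - p) ^ card \<tau>" using p1 st(4) by (intro power_decreasing) auto
      finally have half: "1/2 \<le> (1 - p) ^ card \<tau>" .
      have "p ^ card \<sigma> * (1/2) * (real n / 2) \<le> p ^ card \<sigma> * (1 - p) ^ card \<tau> * (real n - real (card \<sigma> + card \<tau>))"
        using half p1 n st(4) by (intro mult_mono) auto
      then have "real n * p ^ card \<sigma> / 16 - p ^ card \<sigma> * (1 - p) ^ card \<tau> * (real n - real (card \<sigma> + card \<tau>)) / 2
          \<le> - (real n * p ^ card \<sigma>) / 16"
        by (simp add: mult.commute[of "p ^ card \<sigma>" "real n"])
      also have "\<dots> \<le> - (real n * p ^ d) / 16"
        using mult_left_mono[OF pd, of "real n"] by simp
      finally have le: "real n * p ^ card \<sigma> / 16 - p ^ card \<sigma> * (1 - p) ^ card \<tau> * (real n - real (card \<sigma> + card \<tau>)) / 2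
          \<le> - (real n * p ^ d) / 16" .
      have "bexp (all_edges n) p (\<lambda>X. of_bool (b2 X \<sigma> \<tau>))
          \<le> bexp (all_edges n) p (\<lambda>X. of_bool (real (card (ext n X \<sigma> \<tau>)) \<le> real n * p ^ card \<sigma> / 16))"
        using p1 by (intro bexp_mono) (auto simp: b2_def)
      also have "\<dots> \<le> exp (real n * p ^ card \<sigma> / 16 - p ^ card \<sigma> * (1 - p) ^ card \<tau> * (real n - real (card \<sigma> + card \<tau>)) / 2)"
        by (rule ext_lower_tail[OF st(1-3) p1])
      also have "\<dots> \<le> ?b" using le by (simp only: exp_le_cancel_iff)
      finally show ?thesis .
    qed
    have "(\<Sum>(\<sigma>, \<tau>)\<in>disjoint_pairs n (Suc k). bexp (all_edges n) p (\<lambda>X. of_bool (b2 X \<sigma> \<tau>)))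
        \<le> (\<Sum>_\<in>disjoint_pairs n (Suc k). ?b)"
      using b by (intro sum_mono) auto
    also have "\<dots> = real (card (disjoint_pairs n (Suc k))) * ?b" by simp
    also have "\<dots> \<le> real (Suc (Suc k) * n ^ Suc k) * ?b"
      by (intro mult_right_mono of_nat_mono card_disjoint_pairs) simp
    finally show "(\<Sum>(\<sigma>, \<tau>)\<in>disjoint_pairs n (Suc k). bexp (all_edges n) p (\<lambda>X. of_bool (b2 X \<sigma> \<tau>)))
        \<le> real (Suc (Suc k) * n ^ Suc k) * ?b" .
  qed
  finally show ?thesis .
qed

theorem Ztilde_vanishing_overwhelming:
  fixes \<alpha> :: real
  assumes k: "1 \<le> k" "k \<le> 2 * d" and d: "d \<ge> 1" and \<alpha>: "\<alpha> > 0" "\<alpha> < 1 / real d"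
  shows "overwhelming (\<lambda>n. real n powr (- \<alpha>)) (\<lambda>n E. rat_homology_vanishes (Ztilde n E) k)"
  unfolding overwhelming_def
proof (intro allI impI)
  fix C :: real assume C: "C > 0"
  define \<delta> where "\<delta> = 1 - \<alpha> * real d"
  have \<delta>: "\<delta> > 0" using \<alpha> d by (simp add: \<delta>_def field_simps)
  obtain j :: nat where j: "(real k + 2 + C) / \<delta> < 2 ^ j"
    using real_arch_pow[of 2] by auto
  define L :: nat where "L = 2 ^ Suc j"
  define \<mu> where "\<mu> = 1 / (64 * real (Suc k))"
  define K where "K = real (Suc k) * (real (Suc L) ^ (L + 2) * 2 ^ Suc L / \<mu> ^ L)"
  have \<mu>0: "\<mu> > 0" by (simp add: \<mu>_def)
  have K0: "K \<ge> 0" using \<mu>0 by (simp add: K_def)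
  have lim: "((\<lambda>n::nat. real n powr (- \<alpha>)) \<longlongrightarrow> 0) at_top" using \<alpha>(1) by real_asymp
  have "((\<lambda>n::nat. (1 - real n powr (- \<alpha>)) ^ Suc k) \<longlongrightarrow> (1 - 0) ^ Suc k) at_top"
    by (intro tendsto_intros lim)
  then have "eventually (\<lambda>n::nat. (1 - real n powr (- \<alpha>)) ^ Suc k > 1/2) at_top"
    by (rule order_tendstoD) simp
  moreover have "eventually (\<lambda>n::nat. real n powr (- \<alpha>) < 1/3) at_top"
    using lim by (rule order_tendstoD) simp
  moreover have "eventually (\<lambda>n::nat. K * real n powr (- C - 1) \<le> real n powr (- C) / 2) at_top"
    by (rule eventually_const_mult_powr_le)
  moreover have "eventually (\<lambda>n::nat. real (Suc (Suc k)) * (real n ^ Suc k * exp (- (real n powr \<delta>) / 16)) \<le> real n powr (- C) / 2) at_top"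
    by (rule eventually_power_mult_exp_le[OF \<delta>])
  moreover have "eventually (\<lambda>n::nat. n \<ge> 2 * Suc k) at_top" by (rule eventually_ge_at_top)
  ultimately show "eventually (\<lambda>n. 1 - prob_Gnp n (real n powr (- \<alpha>)) (\<lambda>E. rat_homology_vanishes (Ztilde n E) k) \<le> real n powr (- C)) at_top"
  proof eventually_elim
    case (elim n)
    define p where "p = real n powr (- \<alpha>)"
    have n1: "real n \<ge> 1" using elim(5) by simp
    have p: "0 < p" "p \<le> 1/3" using elim(2) n1 by (auto simp: p_def)
    have npd: "real n * p ^ d = real n powr \<delta>"
    proof -
      have "p ^ d = real n powr (- \<alpha> * real d)"
        using n1 by (simp add: p_def powr_powr flip: powr_realpow)
      then have "real n * p ^ d = real n powr 1 * real n powr (- \<alpha> * real d)" using n1 by simp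
      also have "\<dots> = real n powr \<delta>" unfolding powr_add[symmetric] by (simp add: \<delta>_def)
      finally show ?thesis .
    qed
    have npd1: "real n * p ^ d \<ge> 1" unfolding npd using n1 \<delta> by (simp add: ge_one_powr_ge_zero)
    have "1 - prob_Gnp n p (\<lambda>E. rat_homology_vanishes (Ztilde n E) k)
      \<le> real (Suc k * n ^ k) * (real (Suc L) ^ (L + 2) * 2 ^ Suc L * real n / (\<mu> ^ L * (real n * p ^ d) ^ (2 ^ j)))
        + real (Suc (Suc k) * n ^ Suc k) * exp (- (real n * p ^ d) / 16)"
      using elim(1,5) by (intro failure_probability[OF k p npd1 _ _ \<mu>_def L_def]) (auto simp: p_def)
    also have "real (Suc k * n ^ k) * (real (Suc L) ^ (L + 2) * 2 ^ Suc L * real n / (\<mu> ^ L * (real n * p ^ d) ^ (2 ^ j)))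
        = K * (real n ^ Suc k / (real n powr \<delta>) ^ (2 ^ j))"
      unfolding npd K_def of_nat_mult of_nat_power by simp
    also have "real n ^ Suc k / (real n powr \<delta>) ^ (2 ^ j) = real n powr (real (Suc k) - \<delta> * 2 ^ j)"
    proof -
      have "(real n powr \<delta>) ^ (2 ^ j) = real n powr (\<delta> * 2 ^ j)"
        using n1 by (simp add: powr_powr flip: powr_realpow)
      moreover have "real n ^ Suc k = real n powr real (Suc k)" using n1 by (subst powr_realpow) auto
      ultimately show ?thesis by (simp only: powr_diff)
    qed
    also have "K * real n powr (real (Suc k) - \<delta> * 2 ^ j) \<le> K * real n powr (- C - 1)"
    proof -
      have "real k + 2 + C < \<delta> * 2 ^ j" using j \<delta> by (simp add: field_simps)
      then show ?thesis using n1 K0 by (intro mult_left_mono powr_mono) auto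
    qed
    also have "\<dots> \<le> real n powr (- C) / 2" by (rule elim(3))
    also have "real (Suc (Suc k) * n ^ Suc k) * exp (- (real n * p ^ d) / 16) \<le> real n powr (- C) / 2"
      using elim(4) unfolding npd of_nat_mult of_nat_power mult.assoc .
    finally show ?case by (simp add: p_def)
  qed
qed

theorem theorem6p1:
  fixes d :: nat and \<alpha> :: real
  assumes "d \<ge> 1" and "\<alpha> > 0"
  shows "(\<alpha> < 1 / real d \<longrightarrow>
           overwhelming (\<lambda>n. real n powr (- \<alpha>))
             (\<lambda>n E. rat_homology_vanishes (Ztilde n E) (2 * d)))
       \<and> (\<alpha> < 1 / real (d + 1) \<longrightarrow>
           overwhelming (\<lambda>n. real n powr (- \<alpha>))
             (\<lambda>n E. rat_homology_vanishes (Ztilde n E) (2 * d - 1)))"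
proof (intro conjI impI)
  assume "\<alpha> < 1 / real d"
  then show "overwhelming (\<lambda>n. real n powr (- \<alpha>)) (\<lambda>n E. rat_homology_vanishes (Ztilde n E) (2 * d))"
    using assms by (intro Ztilde_vanishing_overwhelming[of _ d]) auto
next
  assume "\<alpha> < 1 / real (d + 1)"
  also have "\<dots> \<le> 1 / real d" using assms by (intro divide_left_mono) auto
  finally show "overwhelming (\<lambda>n. real n powr (- \<alpha>)) (\<lambda>n E. rat_homology_vanishes (Ztilde n E) (2 * d - 1))"
    using assms by (intro Ztilde_vanishing_overwhelming[of _ d]) auto
qed

end
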